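(* For every $n\ge 3$ and $d\ge 3$, the smooth Veronese-Avoiding locus $\mathscr V_{n,d}^{\mathrm{sm}}$ is nonempty.
   Context: $k$ is an algebraically closed field of characteristic zero, $R=k[x_1,\ldots,x_n]$ is the standard graded polynomial ring with graded pieces $R_m$, and for $f\in R_d$ the gradient ideal is $J_f=(\partial f/\partial x_1,\ldots,\partial f/\partial x_n)$, with degree-$m$ piece $(J_f)_m$. Set $T=n(d-2)$. $\mathbb{P}((J_f)_m)\subseteq\mathbb{P}(R_m)$ is the projective linear subspace attached to $(J_f)_m$, of codimension $\dim_k R_m-\dim_k (J_f)_m$. The Veronese variety $V_n^m\subseteq \mathbb{P}(R_m)$ is the image of $\mathbb{P}(R_1)\to\mathbb{P}(R_m)$, $[\ell]\mapsto[\ell^m]$. A reduced hypersurface $V(f)\subseteq\mathbb{P}_k^{n-1}$ is called Veronese-Avoiding if (I) $\mathrm{codim}_{\mathbb{P}(R_{T-1})}\mathbb{P}((J_f)_{T-1})=n$ and (II) $\mathbb{P}((J_f)_{T-1})\cap V_n^{T-1}=\emptyset$. $\mathscr V_{n,d}=\{[f]\in\mathbb{P}(R_d)\mid V(f)\text{ is Veronese-Avoiding}\}$, $\mathscr U_{n,d}\subseteq\mathbb{P}(R_d)$ is the open locus of smooth hypersurfaces, and $\mathscr V_{n,d}^{\mathrm{sm}}=\mathscr V_{n,d}\cap\mathscr U_{n,d}$. *)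

theory Defs
  imports
    "HOL-Library.Poly_Mapping"
    "HOL-Computational_Algebra.Computational_Algebra"
begin

text \<open>
  Monomials are exponent vectors, polynomials are finitely supported coefficient functions on
  monomials with the convolution product of \<^theory>\<open>HOL-Library.Poly_Mapping\<close>. The type has the
  countably many variables \<open>x\<^sub>0, x\<^sub>1, \<dots>\<close>; the ring \<open>k[x\<^sub>1,\<dots>,x\<^sub>n]\<close> is its subring of the
  polynomials involving only the variables with index \<open>< n\<close>.
\<close>

type_synonym monomial = "nat \<Rightarrow>\<^sub>0 nat"
type_synonym 'k mpoly = "monomial \<Rightarrow>\<^sub>0 'k"

definition poly_ring :: "nat \<Rightarrow> 'k::field mpoly set" where
  "poly_ring n = {p. \<forall>m \<in> Poly_Mapping.keys p. Poly_Mapping.keys m \<subseteq> {..<n}}"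

definition monomial_degree :: "monomial \<Rightarrow> nat" where
  "monomial_degree m = (\<Sum>i \<in> Poly_Mapping.keys m. Poly_Mapping.lookup m i)"

definition graded_piece :: "nat \<Rightarrow> nat \<Rightarrow> 'k::field mpoly set" where
  "graded_piece n e = {p \<in> poly_ring n. \<forall>m \<in> Poly_Mapping.keys p. monomial_degree m = e}"

text \<open>
  If \<open>x\<^sub>i\<close> does not occur in \<open>m\<close>, the truncated exponent \<open>m - x\<^sub>i = m\<close> is harmless, because the
  coefficient of the corresponding summand is \<open>0\<close>.
\<close>

definition partial_deriv :: "nat \<Rightarrow> 'k::field mpoly \<Rightarrow> 'k mpoly" where
  "partial_deriv i p =
     (\<Sum>m \<in> Poly_Mapping.keys p.
        Poly_Mapping.single (m - Poly_Mapping.single i 1)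
          (of_nat (Poly_Mapping.lookup m i) * Poly_Mapping.lookup p m))"

definition eval_mpoly :: "(nat \<Rightarrow> 'k::field) \<Rightarrow> 'k mpoly \<Rightarrow> 'k" where
  "eval_mpoly a p =
     (\<Sum>m \<in> Poly_Mapping.keys p.
        Poly_Mapping.lookup p m * (\<Prod>i \<in> Poly_Mapping.keys m. a i ^ Poly_Mapping.lookup m i))"

definition gradient_ideal :: "nat \<Rightarrow> 'k::field mpoly \<Rightarrow> 'k mpoly set" where
  "gradient_ideal n f =
     {(\<Sum>i<n. g i * partial_deriv i f) | g. \<forall>i<n. g i \<in> poly_ring n}"

definition gradient_ideal_piece :: "nat \<Rightarrow> 'k::field mpoly \<Rightarrow> nat \<Rightarrow> 'k mpoly set" where
  "gradient_ideal_piece n f e = gradient_ideal n f \<inter> graded_piece n e"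

definition scale_mpoly :: "'k::field \<Rightarrow> 'k mpoly \<Rightarrow> 'k mpoly" where
  "scale_mpoly c p = Poly_Mapping.single 0 c * p"

global_interpretation mpoly: vector_space "scale_mpoly :: 'k::field \<Rightarrow> 'k mpoly \<Rightarrow> 'k mpoly"
  defines mpoly_span = mpoly.span
    and mpoly_dim = mpoly.dim
  by unfold_locales
    (simp_all add: scale_mpoly_def algebra_simps single_add mult_single flip: mult.assoc)

text \<open>
  Projective space is the set of lines: the point \<open>[v]\<close>, for \<open>v \<noteq> 0\<close>, is the line spanned by \<open>v\<close>,
  and \<open>\<P>(V)\<close> is the set of the points \<open>[v]\<close> with \<open>v \<in> V\<close> nonzero.
\<close>

definition proj_point :: "'k::field mpoly \<Rightarrow> 'k mpoly set" where
  "proj_point v = mpoly_span {v}"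

definition proj_space :: "'k::field mpoly set \<Rightarrow> 'k mpoly set set" where
  "proj_space V = proj_point ` (V - {0})"

definition proj_codim :: "'k::field mpoly set \<Rightarrow> 'k mpoly set \<Rightarrow> int" where
  "proj_codim W V = int (mpoly_dim W) - int (mpoly_dim V)"

definition veronese_variety :: "nat \<Rightarrow> nat \<Rightarrow> 'k::field mpoly set set" where
  "veronese_variety n e = {proj_point (l ^ e) | l. l \<in> graded_piece n 1 \<and> l \<noteq> 0}"

text \<open>
  The hypersurface \<open>V(f)\<close> is reduced iff \<open>f\<close> has no repeated factor. The quantifiers range over
  \<open>k[x\<^sub>1,\<dots>,x\<^sub>n]\<close>, whereas \<^const>\<open>squarefree\<close> would also admit factors in further variables.
\<close>

definition reduced_hypersurface :: "nat \<Rightarrow> 'k::field mpoly \<Rightarrow> bool" where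
  "reduced_hypersurface n f \<longleftrightarrow>
     f \<noteq> 0 \<and>
     (\<forall>g \<in> poly_ring n. \<forall>h \<in> poly_ring n. f = g ^ 2 * h \<longrightarrow> (\<exists>u \<in> poly_ring n. g * u = 1))"

text \<open>
  Over an algebraically closed field the points of projective \<open>(n-1)\<close>-space are given by
  coordinate vectors that are not all zero; smoothness is the Jacobian criterion at every point
  of \<open>V(f)\<close>.
\<close>

definition smooth_hypersurface :: "nat \<Rightarrow> 'k::field mpoly \<Rightarrow> bool" where
  "smooth_hypersurface n f \<longleftrightarrow>
     f \<noteq> 0 \<and>
     (\<forall>a. (\<exists>i<n. a i \<noteq> 0) \<and> eval_mpoly a f = 0 \<longrightarrow>
          (\<exists>i<n. eval_mpoly a (partial_deriv i f) \<noteq> 0))"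

definition socle_degree :: "nat \<Rightarrow> nat \<Rightarrow> nat" where
  "socle_degree n d = n * (d - 2)"

definition veronese_avoiding :: "nat \<Rightarrow> nat \<Rightarrow> 'k::field mpoly \<Rightarrow> bool" where
  "veronese_avoiding n d f \<longleftrightarrow>
     (let e = socle_degree n d - 1 in
        f \<in> graded_piece n d \<and> reduced_hypersurface n f \<and>
        proj_codim (graded_piece n e) (gradient_ideal_piece n f e) = int n \<and>
        proj_space (gradient_ideal_piece n f e) \<inter> veronese_variety n e = {})"

definition veronese_avoiding_locus :: "nat \<Rightarrow> nat \<Rightarrow> 'k::field mpoly set set" where
  "veronese_avoiding_locus n d =
     {proj_point f | f. f \<in> graded_piece n d \<and> f \<noteq> 0 \<and> veronese_avoiding n d f}"

definition smooth_locus :: "nat \<Rightarrow> nat \<Rightarrow> 'k::field mpoly set set" where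
  "smooth_locus n d =
     {proj_point f | f. f \<in> graded_piece n d \<and> f \<noteq> 0 \<and> smooth_hypersurface n f}"

definition smooth_veronese_avoiding_locus :: "nat \<Rightarrow> nat \<Rightarrow> 'k::field mpoly set set" where
  "smooth_veronese_avoiding_locus n d = veronese_avoiding_locus n d \<inter> smooth_locus n d"

end

theory Submission
  imports Defs "HOL-Library.FuncSet"
begin

text \<open>
  Write \<open>m = d - 1\<close>, \<open>e = n(d - 2) - 1\<close> and \<open>s = x\<^sub>0 + \<dots> + x\<^sub>n\<^sub>-\<^sub>1\<close>. The witness is a general member of the
  pencil \<open>f\<^sub>c = x\<^sub>0\<^sup>d + \<dots> + x\<^sub>n\<^sub>-\<^sub>1\<^sup>d - c s\<^sup>d\<close>. Its partial derivatives are multiples of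
  \<open>x\<^sub>i\<^sup>m - c s\<^sup>m\<close>, so the gradient ideal contains all \<open>x\<^sub>i\<^sup>m - x\<^sub>0\<^sup>m\<close>, the equations of the finite grid
  \<open>G\<close> of points whose coordinates are \<open>m\<close>-th roots of unity, and one further form
  \<open>x\<^sub>0\<^sup>m - c s\<^sup>m\<close>. The singular points of \<open>f\<^sub>c\<close> are the points \<open>p\<close> of \<open>G\<close> with \<open>c s(p)\<^sup>m = 1\<close>. For all
  but finitely many \<open>c\<close> there are none, and then \<open>f\<^sub>c\<close> is smooth and reduced.

  For such a \<open>c\<close> the gradient ideal in degree \<open>e\<close> is described by Fourier analysis on \<open>G\<close>. A form
  of degree \<open>e\<close> belongs to it iff, as a function on \<open>G\<close>, its quotient by \<open>1 - c s\<^sup>m\<close> is the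
  restriction of a form of degree \<open>e - m\<close>, that is, iff \<open>n\<close> Fourier coefficients of the quotient
  vanish. These are the functionals
  \<open>g \<mapsto> \<Sum>\<^sub>p p\<^sub>0\<cdots>p\<^sub>n\<^sub>-\<^sub>1 \<cdot> p\<^sub>j \<cdot> g(p) / (1 - c s(p)\<^sup>m)\<close> of the definition \<open>residue\<close>. They are linearly independent,
  which gives codimension \<open>n\<close>.

  It remains to choose \<open>c\<close> in such a way that for a nonzero linear form \<open>l\<close> the residues of \<open>l\<^sup>e\<close> do
  not all vanish. The residues have poles at the parameters of the singular members. Let \<open>w\<close> be a
  primitive \<open>m\<close>-th root of unity, conjugate to \<open>exp(2\<pi>\<i>/m)\<close>, and let \<open>q\<^sub>i\<close> be the point with \<open>i\<close>-th
  coordinate \<open>w\<close> and all other coordinates \<open>1\<close>. The member with \<open>c = 1 / (n - 1 + w)\<^sup>m\<close> is singular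
  exactly at the projective points \<open>q\<^sub>0, \<dots>, q\<^sub>n\<^sub>-\<^sub>1\<close>, as a comparison of real parts shows
  (\<open>root_of_unity_with_isolated_sum\<close>). The vectors \<open>q\<^sub>i\<close> form a basis of the space. After
  multiplication by the denominators, the residues of \<open>l\<^sup>e\<close> therefore degenerate for this \<open>c\<close> into
  linearly independent combinations of \<open>l(q\<^sub>0)\<^sup>e, \<dots>, l(q\<^sub>n\<^sub>-\<^sub>1)\<^sup>e\<close>, which vanish simultaneously only for
  \<open>l = 0\<close>.
  Having no common zero other than the origin is an open condition on a system of forms
  (\<open>finite_parameters_with_common_zero\<close>), so it holds for all but finitely many \<open>c\<close>.
\<close>

section \<open>Roots of unity\<close>

definition rat_poly_value :: "'a::field_char_0 \<Rightarrow> rat poly \<Rightarrow> 'a" where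
  "rat_poly_value z q = poly (map_poly of_rat q) z"

lemma rat_poly_value_0 [simp]: "rat_poly_value z 0 = 0"
  by (simp add: rat_poly_value_def)

lemma rat_poly_value_1 [simp]: "rat_poly_value z 1 = 1"
  by (simp add: rat_poly_value_def)

lemma rat_poly_value_add [simp]: "rat_poly_value z (p + q) = rat_poly_value z p + rat_poly_value z q"
proof -
  have "map_poly of_rat (p + q) = (map_poly of_rat p + map_poly of_rat q :: 'a poly)"
    by (rule poly_eqI) (simp add: coeff_map_poly of_rat_add)
  then show ?thesis by (simp add: rat_poly_value_def)
qed

lemma rat_poly_value_diff [simp]: "rat_poly_value z (p - q) = rat_poly_value z p - rat_poly_value z q"
proof -
  have "map_poly of_rat (p - q) = (map_poly of_rat p - map_poly of_rat q :: 'a poly)"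
    by (rule poly_eqI) (simp add: coeff_map_poly of_rat_diff)
  then show ?thesis by (simp add: rat_poly_value_def)
qed

lemma rat_poly_value_mult [simp]: "rat_poly_value z (p * q) = rat_poly_value z p * rat_poly_value z q"
proof -
  have "map_poly of_rat (p * q) = (map_poly of_rat p * map_poly of_rat q :: 'a poly)"
    by (rule poly_eqI) (simp add: coeff_map_poly coeff_mult of_rat_sum of_rat_mult)
  then show ?thesis by (simp add: rat_poly_value_def)
qed

lemma rat_poly_value_monom [simp]: "rat_poly_value z (monom c j) = of_rat c * z ^ j"
  by (simp add: rat_poly_value_def map_poly_monom poly_monom)

lemma rat_poly_value_sum [simp]: "rat_poly_value z (\<Sum>i\<in>A. f i) = (\<Sum>i\<in>A. rat_poly_value z (f i))"
  by (induction A rule: infinite_finite_induct) auto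

lemma minimal_polynomial_exists:
  fixes z :: "'a::field_char_0"
  assumes "p \<noteq> 0" "rat_poly_value z p = 0"
  shows "\<exists>\<mu>. \<mu> \<noteq> 0 \<and> (\<forall>q. rat_poly_value z q = 0 \<longleftrightarrow> \<mu> dvd q)"
proof -
  define P where "P = (\<lambda>q. q \<noteq> 0 \<and> rat_poly_value z q = 0)"
  obtain \<mu> where \<mu>: "P \<mu>" "\<And>q. P q \<Longrightarrow> degree \<mu> \<le> degree q"
    using ex_has_least_nat[of P p degree] assms by (auto simp: P_def)
  have "\<mu> dvd q" if q: "rat_poly_value z q = 0" for q
  proof -
    have "rat_poly_value z (q mod \<mu>) = rat_poly_value z (q - q div \<mu> * \<mu>)"
      by (simp add: minus_div_mult_eq_mod)
    also have "\<dots> = 0" using q \<mu>(1) by (simp add: P_def)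
    finally have r: "rat_poly_value z (q mod \<mu>) = 0" .
    have "q mod \<mu> = 0"
      using degree_mod_less[of \<mu> q] \<mu> r unfolding P_def by fastforce
    then show ?thesis by auto
  qed
  then show ?thesis using \<mu>(1) unfolding P_def
    by (intro exI[of _ \<mu>]) (auto elim!: dvdE)
qed

text \<open>
  An element algebraic over the rationals has a conjugate in every algebraically closed field of
  characteristic zero: a root of its minimal polynomial. Through such a conjugate, facts that are
  proved with real parts of complex numbers become available over the given field.
\<close>

lemma conjugate_exists:
  fixes z :: "'a::field_char_0"
  assumes "p \<noteq> 0" "rat_poly_value z p = 0"
  shows "\<exists>w :: 'k::{alg_closed_field, field_char_0}.
           \<forall>q. rat_poly_value w q = 0 \<longleftrightarrow> rat_poly_value z q = 0"
proof -
  obtain \<mu> where \<mu>: "\<mu> \<noteq> 0" "\<And>q. rat_poly_value z q = 0 \<longleftrightarrow> \<mu> dvd q"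
    using minimal_polynomial_exists[OF assms] by blast
  have "degree \<mu> \<noteq> 0"
  proof
    assume "degree \<mu> = 0"
    then have "\<mu> dvd 1" using \<mu>(1) is_unit_iff_degree by blast
    then show False using \<mu>(2)[of 1] by simp
  qed
  then have "degree (map_poly of_rat \<mu> :: 'k poly) > 0"
    by (simp add: degree_map_poly)
  from alg_closed_imp_poly_has_root[OF this] obtain w :: 'k where w: "rat_poly_value w \<mu> = 0"
    by (auto simp: rat_poly_value_def)
  obtain \<nu> where \<nu>: "\<And>q. rat_poly_value w q = 0 \<longleftrightarrow> \<nu> dvd q"
    using minimal_polynomial_exists[OF \<mu>(1) w] by blast
  obtain u where u: "\<mu> = \<nu> * u" using w \<nu> by (auto elim: dvdE)
  have "rat_poly_value z \<nu> * rat_poly_value z u = 0"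
    using \<mu>(2)[of \<mu>] u by simp
  \<comment> \<open>The cofactor \<open>u\<close> cannot vanish at \<open>z\<close>: otherwise it is a multiple of \<open>\<mu>\<close>, and \<open>\<nu>\<close> is a unit.\<close>
  moreover have "rat_poly_value z u \<noteq> 0"
  proof
    assume "rat_poly_value z u = 0"
    then obtain v where "u = \<mu> * v" using \<mu>(2) by (auto elim: dvdE)
    then have "\<mu> * (\<nu> * v) = \<mu> * 1" using u by (simp add: ac_simps)
    then have "\<nu> * v = 1" using \<mu>(1) by simp
    then have "\<nu> dvd 1" by (metis dvdI)
    then show False using \<nu>[of 1] by simp
  qed
  ultimately have "\<mu> dvd \<nu>" using \<mu>(2) by simp
  then have "rat_poly_value w q = 0 \<longleftrightarrow> rat_poly_value z q = 0" for q
    using \<mu>(2) \<nu> u by (metis dvd_trans dvd_triv_left)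
  then show ?thesis by blast
qed

lemma cos_multiple_le:
  assumes "0 < j" "j < (m::nat)"
  shows "cos (2 * pi * real j / real m) \<le> cos (2 * pi / real m)"
proof -
  have mono: "cos (2 * pi * t) \<le> cos (2 * pi * s)" if "0 \<le> s" "s \<le> t" "t \<le> 1 / 2" for s t
  proof (rule cos_monotone_0_pi_le)
    show "0 \<le> 2 * pi * s" using that by simp
    show "2 * pi * s \<le> 2 * pi * t" using that by simp
    have "pi * (2 * t) \<le> pi * 1" using that by (intro mult_left_mono) auto
    then show "2 * pi * t \<le> pi" by simp
  qed
  have j: "1 \<le> real j" "1 + real j \<le> real m" using assms by linarith+
  show ?thesis
  proof (cases "2 * j \<le> m")
    case True
    then have "2 * real j \<le> real m" by linarith
    then show ?thesis using mono[of "1 / real m" "real j / real m"] j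
      by (simp add: divide_simps)
  next
    case False
    then have "real m \<le> 2 * real j" by linarith
    then have "cos (2 * pi * ((real m - real j) / real m)) \<le> cos (2 * pi * (1 / real m))"
      using j by (intro mono) (simp_all add: divide_simps)
    moreover have "2 * pi * ((real m - real j) / real m) = 2 * pi - 2 * pi * real j / real m"
      using assms by (simp add: divide_simps) (simp add: algebra_simps)
    ultimately show ?thesis by (simp add: cos_diff)
  qed
qed

lemma cos_two_pi_div_less_1:
  assumes "2 \<le> (m::nat)"
  shows "cos (2 * pi / real m) < 1"
proof -
  have "pi * 2 \<le> pi * real m" using assms by (intro mult_left_mono) auto
  then have "2 * pi / real m \<le> pi" using assms by (simp add: pos_divide_le_eq)
  moreover have "0 < 2 * pi / real m" using assms by simp
  ultimately have "cos (2 * pi / real m) < cos 0" by (intro cos_monotone_0_pi) auto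
  then show ?thesis by simp
qed

text \<open>
  Among the \<open>m\<close>-th roots of unity other than \<open>1\<close>, none has a larger real part than
  \<open>exp(2\<pi>\<i>/m)\<close>. Two summands different from \<open>1\<close> therefore already make the real part of a sum of
  roots of unity too small.
\<close>

lemma sum_cis_powers_eq:
  fixes k :: "nat \<Rightarrow> nat"
  assumes m: "2 \<le> m" and k: "\<And>i. i < n \<Longrightarrow> k i < m"
  assumes eq: "(\<Sum>i<n. cis (2 * pi / real m) ^ k i) = of_nat n - 1 + cis (2 * pi / real m)"
  shows "\<exists>l<n. cis (2 * pi / real m) ^ k l = cis (2 * pi / real m) \<and> (\<forall>i<n. i \<noteq> l \<longrightarrow> k i = 0)"
proof -
  define \<zeta> where "\<zeta> = cis (2 * pi / real m)"
  define \<gamma> where "\<gamma> = cos (2 * pi / real m)"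
  define B where "B = {i. i < n \<and> k i \<noteq> 0}"
  have B: "finite B" "B \<subseteq> {..<n}" by (auto simp: B_def)
  have split: "(\<Sum>i<n. f (\<zeta> ^ k i)) = (\<Sum>i\<in>B. f (\<zeta> ^ k i)) + of_nat (n - card B) * f 1"
    for f :: "complex \<Rightarrow> 'b::comm_ring_1"
  proof -
    have "(\<Sum>i<n. f (\<zeta> ^ k i)) = (\<Sum>i\<in>{..<n} - B. f (\<zeta> ^ k i)) + (\<Sum>i\<in>B. f (\<zeta> ^ k i))"
      using B by (intro sum.subset_diff) auto
    also have "(\<Sum>i\<in>{..<n} - B. f (\<zeta> ^ k i)) = (\<Sum>i\<in>{..<n} - B. f 1)"
      by (rule sum.cong) (auto simp: B_def)
    finally show ?thesis using B by (simp add: card_Diff_subset)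
  qed
  have cardB: "card B \<le> n" using card_mono[OF _ B(2)] by simp
  have "real n - 1 + \<gamma> = (\<Sum>i<n. Re (\<zeta> ^ k i))"
    using arg_cong[OF eq, of Re] by (simp add: \<zeta>_def \<gamma>_def)
  also have "\<dots> = (\<Sum>i\<in>B. Re (\<zeta> ^ k i)) + real (n - card B)"
    using split[of Re] by simp
  also have "(\<Sum>i\<in>B. Re (\<zeta> ^ k i)) \<le> (\<Sum>i\<in>B. \<gamma>)"
  proof (rule sum_mono)
    fix i assume "i \<in> B"
    then have "cos (2 * pi * real (k i) / real m) \<le> \<gamma>"
      unfolding \<gamma>_def using k by (intro cos_multiple_le) (auto simp: B_def)
    also have "cos (2 * pi * real (k i) / real m) = Re (\<zeta> ^ k i)"
      unfolding \<zeta>_def Complex.DeMoivre by (simp add: mult.commute)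
    finally show "Re (\<zeta> ^ k i) \<le> \<gamma>" .
  qed
  finally have "real n - 1 + \<gamma> \<le> real (card B) * \<gamma> + real (n - card B)" by simp
  moreover have "real (n - card B) = real n - real (card B)" using cardB by (rule of_nat_diff)
  moreover have "(real (card B) - 1) * (1 - \<gamma>) =
      real n - 1 + \<gamma> - (real (card B) * \<gamma> + (real n - real (card B)))"
    by (simp only: left_diff_distrib right_diff_distrib)
  ultimately have "(real (card B) - 1) * (1 - \<gamma>) \<le> 0" by linarith
  moreover have "\<gamma> < 1" unfolding \<gamma>_def by (rule cos_two_pi_div_less_1[OF m])
  ultimately have "real (card B) - 1 \<le> 0"
    by (metis diff_gt_0_iff_gt mult_le_0_iff not_less)
  then have le1: "card B \<le> 1" by simp
  have sumB: "(\<Sum>i\<in>B. \<zeta> ^ k i) + of_nat (n - card B) = of_nat n - 1 + \<zeta>"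
    using split[of "\<lambda>x. x"] eq by (simp add: \<zeta>_def)
  have "card B \<noteq> 0"
  proof
    assume "card B = 0"
    then have "B = {}" using B(1) by simp
    then have "\<zeta> = 1" using sumB by simp
    moreover have "\<gamma> = Re \<zeta>" by (simp add: \<zeta>_def \<gamma>_def)
    ultimately have "\<gamma> = 1" by simp
    with \<open>\<gamma> < 1\<close> show False by simp
  qed
  with le1 have "card B = 1" by simp
  then obtain l where l: "B = {l}" by (auto simp: card_1_singleton_iff)
  moreover have "of_nat (n - card B) = (of_nat n - of_nat (card B) :: complex)"
    using cardB by (rule of_nat_diff)
  ultimately have "\<zeta> ^ k l = \<zeta>" using sumB by simp
  moreover have "i < n \<and> k i \<noteq> 0 \<longleftrightarrow> i = l" for i
    using l unfolding B_def by blast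
  ultimately show ?thesis unfolding \<zeta>_def by blast
qed

lemma power_commuting_power: "((w::'a::comm_monoid_mult) ^ j) ^ m = (w ^ m) ^ j"
  by (metis mult.commute power_mult)

lemma primitive_root_powers:
  fixes w :: "'k::field"
  assumes m: "0 < m" and w: "w ^ m = 1" "\<And>j. 0 < j \<Longrightarrow> j < m \<Longrightarrow> w ^ j \<noteq> 1"
  shows "inj_on (\<lambda>j. w ^ j) {..<m}" and "{z. z ^ m = 1} = (\<lambda>j. w ^ j) ` {..<m}"
proof -
  have w0: "w \<noteq> 0" using w(1) m by (auto simp: power_0_left)
  show inj: "inj_on (\<lambda>j. w ^ j) {..<m}"
  proof (rule linorder_inj_onI)
    fix i j assume ij: "i < j" "i \<in> {..<m}" "j \<in> {..<m}"
    show "w ^ i \<noteq> w ^ j"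
    proof
      assume "w ^ i = w ^ j"
      also have "w ^ j = w ^ i * w ^ (j - i)" using ij by (simp flip: power_add)
      finally have "w ^ (j - i) = 1" using w0 by simp
      moreover have "0 < j - i" "j - i < m" using ij by auto
      ultimately show False using w(2) by blast
    qed
  qed auto
  define p where "p = monom 1 m - (1 :: 'k poly)"
  have "coeff p m = 1" using m by (simp add: p_def)
  then have p0: "p \<noteq> 0" by auto
  have "degree p \<le> m"
    unfolding p_def by (intro degree_diff_le) (auto simp: degree_monom_le)
  then have le: "card {z. poly p z = 0} \<le> m"
    using card_poly_roots_bound[OF p0] by simp
  have roots: "{z. z ^ m = 1} = {z. poly p z = 0}"
    by (simp add: p_def poly_monom)
  have sub: "(\<lambda>j. w ^ j) ` {..<m} \<subseteq> {z. z ^ m = 1}"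
    by (simp add: image_subset_iff power_commuting_power[of w _ m] w(1))
  show "{z. z ^ m = 1} = (\<lambda>j. w ^ j) ` {..<m}"
    using card_seteq[OF _ sub] poly_roots_finite[OF p0] le card_image[OF inj] roots by auto
qed

text \<open>
  The last property says that a grid point with coordinate sum \<open>n - 1 + w\<close> has exactly one
  coordinate \<open>w\<close> and otherwise coordinates \<open>1\<close>. It is a statement about polynomial equations
  with rational coefficients for \<open>w\<close>, so it suffices to know it for the conjugate \<open>exp(2\<pi>\<i>/m)\<close>.
\<close>

lemma root_of_unity_with_isolated_sum:
  assumes m: "2 \<le> m"
  shows "\<exists>w :: 'k::{alg_closed_field, field_char_0}. w ^ m = 1 \<and> (\<forall>j. 0 < j \<and> j < m \<longrightarrow> w ^ j \<noteq> 1) \<and>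
           (\<forall>n\<ge>3. of_nat n - 1 + w \<noteq> 0) \<and>
           (\<forall>n z. (\<forall>i<n. z i ^ m = 1) \<and> (\<Sum>i<n. z i) = of_nat n - 1 + w \<longrightarrow>
              (\<exists>l<n. z l = w \<and> (\<forall>i<n. i \<noteq> l \<longrightarrow> z i = 1)))"
proof -
  define \<zeta> where "\<zeta> = cis (2 * pi / real m)"
  have \<zeta>m: "\<zeta> ^ m = 1" using m by (simp add: \<zeta>_def Complex.DeMoivre)
  have "monom 1 m - 1 \<noteq> (0 :: rat poly)"
  proof -
    have "coeff (monom 1 m - 1 :: rat poly) m = 1" using m by simp
    then show ?thesis by (metis coeff_0 zero_neq_one)
  qed
  moreover have "rat_poly_value \<zeta> (monom 1 m - 1) = 0" by (simp add: \<zeta>m)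
  ultimately obtain w :: 'k where w: "\<And>q. rat_poly_value w q = 0 \<longleftrightarrow> rat_poly_value \<zeta> q = 0"
    using conjugate_exists by blast
  have wm: "w ^ m = 1" using w[of "monom 1 m - 1"] \<zeta>m by simp
  have prim: "w ^ j \<noteq> 1" if "0 < j" "j < m" for j
  proof
    assume "w ^ j = 1"
    then have "\<zeta> ^ j = 1" using w[of "monom 1 j - 1"] by simp
    then have "cos (2 * pi * real j / real m) = 1"
      by (simp add: \<zeta>_def Complex.DeMoivre complex_eq_iff mult_ac)
    then show False using cos_multiple_le[OF that] cos_two_pi_div_less_1[OF m] by simp
  qed
  have N0: "of_nat n - 1 + w \<noteq> 0" if "n \<ge> 3" for n
  proof
    assume "of_nat n - 1 + w = 0"
    then have "rat_poly_value w (monom (of_nat n) 0 - 1 + monom 1 1) = 0" by simp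
    then have "rat_poly_value \<zeta> (monom (of_nat n) 0 - 1 + monom 1 1) = 0" using w by blast
    then have "of_nat n - 1 + \<zeta> = 0" by simp
    then have "Re (of_nat n - 1 + \<zeta>) = 0" by simp
    then have "real n - 1 + cos (2 * pi / real m) = 0" by (simp add: \<zeta>_def)
    then show False using that cos_ge_minus_one[of "2 * pi / real m"] by linarith
  qed
  have iso: "\<exists>l<n. z l = w \<and> (\<forall>i<n. i \<noteq> l \<longrightarrow> z i = 1)"
    if z: "\<forall>i<n. z i ^ m = 1" and s: "(\<Sum>i<n. z i) = of_nat n - 1 + w" for n and z :: "nat \<Rightarrow> 'k"
  proof -
    have "\<exists>j<m. z i = w ^ j" if "i < n" for i
    proof -
      have "z i \<in> {z. z ^ m = 1}" using z that by simp
      then show ?thesis using primitive_root_powers(2)[OF _ wm prim] m by auto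
    qed
    then obtain k where k: "\<And>i. i < n \<Longrightarrow> k i < m \<and> z i = w ^ k i" by metis
    have "(\<Sum>i<n. w ^ k i) = of_nat n - 1 + w" using s k by simp
    then have "rat_poly_value w ((\<Sum>i<n. monom 1 (k i)) - (monom (of_nat n) 0 - 1 + monom 1 1)) = 0"
      by simp
    then have "rat_poly_value \<zeta> ((\<Sum>i<n. monom 1 (k i)) - (monom (of_nat n) 0 - 1 + monom 1 1)) = 0"
      using w by blast
    then have "(\<Sum>i<n. \<zeta> ^ k i) = of_nat n - 1 + \<zeta>" by simp
    then obtain l where l: "l < n" "\<zeta> ^ k l = \<zeta>" "\<forall>i<n. i \<noteq> l \<longrightarrow> k i = 0"
      using sum_cis_powers_eq[OF m, of n k] k unfolding \<zeta>_def by blast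
    have "w ^ k l = w" using w[of "monom 1 (k l) - monom 1 1"] l(2) by simp
    then show ?thesis using l k by (metis power_0)
  qed
  show ?thesis using wm prim N0 iso by blast
qed

lemma primitive_root_exists:
  assumes "0 < m"
  shows "\<exists>w :: 'k::{alg_closed_field, field_char_0}. w ^ m = 1 \<and> (\<forall>j. 0 < j \<and> j < m \<longrightarrow> w ^ j \<noteq> 1)"
proof (cases "m = 1")
  case True
  then show ?thesis by (intro exI[of _ 1]) auto
next
  case False
  then have "2 \<le> m" using assms by simp
  from root_of_unity_with_isolated_sum[OF this] show ?thesis by blast
qed

lemma
  fixes m :: nat
  assumes m: "0 < m"
  shows finite_unity_roots: "finite {z :: 'k::{alg_closed_field, field_char_0}. z ^ m = 1}"
    and card_unity_roots: "card {z :: 'k. z ^ m = 1} = m"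
proof -
  obtain w :: 'k where w: "w ^ m = 1" "\<And>j. 0 < j \<Longrightarrow> j < m \<Longrightarrow> w ^ j \<noteq> 1"
    using primitive_root_exists[OF m] by blast
  note powers = primitive_root_powers[OF m w]
  have "finite ((\<lambda>j. w ^ j) ` {..<m})" by simp
  then show "finite {z :: 'k. z ^ m = 1}" by (simp only: powers(2))
  show "card {z :: 'k. z ^ m = 1} = m" using card_image[OF powers(1)] by (simp only: powers(2) card_lessThan)
qed

lemma sum_unity_roots_power:
  fixes m :: nat
  assumes m: "0 < m"
  shows "(\<Sum>z\<in>{z :: 'k::{alg_closed_field, field_char_0}. z ^ m = 1}. z ^ b) = (if m dvd b then of_nat m else 0)"
proof (cases "m dvd b")
  case True
  then obtain r where "b = m * r" by (elim dvdE)
  then have "(\<Sum>z\<in>{z :: 'k. z ^ m = 1}. z ^ b) = (\<Sum>z\<in>{z :: 'k. z ^ m = 1}. 1)"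
    by (intro sum.cong) (auto simp: power_mult)
  then show ?thesis using True card_unity_roots[OF m, where 'k = 'k] by simp
next
  case False
  obtain w :: 'k where w: "w ^ m = 1" "\<And>j. 0 < j \<Longrightarrow> j < m \<Longrightarrow> w ^ j \<noteq> 1"
    using primitive_root_exists[OF m] by blast
  have w0: "w \<noteq> 0" using w(1) m by (auto simp: power_0_left)
  let ?S = "\<Sum>z\<in>{z :: 'k. z ^ m = 1}. z ^ b"
  have "w ^ b = (w ^ m) ^ (b div m) * w ^ (b mod m)"
    by (simp flip: power_mult power_add)
  then have "w ^ b = w ^ (b mod m)" using w(1) by simp
  moreover have "0 < b mod m" "b mod m < m" using False m by (auto simp: mod_greater_zero_iff_not_dvd)
  ultimately have "w ^ b \<noteq> 1" using w(2) by simp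
  have "?S = (\<Sum>z\<in>{z :: 'k. z ^ m = 1}. (w * z) ^ b)"
    by (rule sum.reindex_bij_witness[of _ "\<lambda>z. w * z" "\<lambda>z. z / w"])
       (auto simp: w0 power_divide power_mult_distrib w(1))
  also have "\<dots> = w ^ b * ?S" by (simp add: power_mult_distrib sum_distrib_left)
  finally have "(w ^ b - 1) * ?S = 0" by (simp add: algebra_simps)
  then show ?thesis using \<open>w ^ b \<noteq> 1\<close> False by simp
qed

section \<open>Fourier analysis on the grid of roots of unity\<close>

text \<open>
  The functions on the grid carry the Fourier analysis of the finite abelian group \<open>\<mu>\<^sub>m\<^sup>n\<close>; the characters
  are the restrictions of the monomials with exponents less than \<open>m\<close>.
\<close>

definition unity_grid :: "nat \<Rightarrow> nat \<Rightarrow> (nat \<Rightarrow> 'k::field) set" where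
  "unity_grid m n = {..<n} \<rightarrow>\<^sub>E {z. z ^ m = 1}"

lemma unity_grid_power: "p \<in> unity_grid m n \<Longrightarrow> i < n \<Longrightarrow> p i ^ m = 1"
  by (auto simp: unity_grid_def)

lemma finite_unity_grid [simp]:
  "0 < m \<Longrightarrow> finite (unity_grid m n :: (nat \<Rightarrow> 'k::{alg_closed_field, field_char_0}) set)"
  unfolding unity_grid_def by (intro finite_PiE finite_unity_roots) auto

lemma sum_unity_grid_monomial:
  assumes "0 < m"
  shows "(\<Sum>p\<in>unity_grid m n. \<Prod>i<n. p i ^ \<beta> i) =
    (if \<forall>i<n. m dvd \<beta> i then of_nat m ^ n else 0 :: 'k::{alg_closed_field, field_char_0})"
proof -
  have "(\<Sum>p\<in>unity_grid m n. \<Prod>i<n. p i ^ \<beta> i) = (\<Prod>i<n. \<Sum>z\<in>{z :: 'k. z ^ m = 1}. z ^ \<beta> i)"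
    unfolding unity_grid_def using assms by (intro prod_sum_PiE[symmetric] finite_unity_roots) auto
  also have "\<dots> = (\<Prod>i<n. if m dvd \<beta> i then of_nat m else 0)"
    by (simp add: sum_unity_roots_power[OF assms])
  also have "\<dots> = (if \<forall>i<n. m dvd \<beta> i then of_nat m ^ n else 0)"
    by (auto intro: prod_zero)
  finally show ?thesis .
qed

lemma sum_characters_at_pair:
  assumes m: "0 < m" and p: "p \<in> unity_grid m n" and q: "q \<in> unity_grid m n"
  shows "(\<Sum>\<alpha>\<in>{..<n} \<rightarrow>\<^sub>E {..<m}. \<Prod>i<n. p i ^ \<alpha> i * q i ^ (m - \<alpha> i)) =
    (if p = q then of_nat m ^ n else 0 :: 'k::{alg_closed_field, field_char_0})"
proof -
  have factor: "(\<Sum>a<m. p i ^ a * q i ^ (m - a)) = (if p i = q i then of_nat m else 0)" if i: "i < n" for i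
  proof -
    have pm: "p i ^ m = 1" "q i ^ m = 1" using p q i by (auto dest: unity_grid_power)
    then have q0: "q i \<noteq> 0" using m by (auto simp: power_0_left)
    have "(\<Sum>a<m. p i ^ a * q i ^ (m - a)) = (\<Sum>a<m. (p i / q i) ^ a)"
    proof (rule sum.cong[OF refl])
      fix a assume a: "a \<in> {..<m}"
      then have "q i ^ a * q i ^ (m - a) = 1" using pm by (simp flip: power_add)
      then have "q i ^ (m - a) = 1 / q i ^ a" using q0 by (simp add: field_simps)
      then show "p i ^ a * q i ^ (m - a) = (p i / q i) ^ a" by (simp add: power_divide)
    qed
    also have "\<dots> = (if p i = q i then of_nat m else 0)"
    proof (cases "p i = q i")
      case False
      then have "p i / q i \<noteq> 1" using q0 by simp
      then have "(\<Sum>a<m. (p i / q i) ^ a) = ((p i / q i) ^ m - 1) / (p i / q i - 1)"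
        by (rule geometric_sum)
      then show ?thesis using False pm by (simp add: power_divide)
    qed (use q0 in simp)
    finally show ?thesis .
  qed
  have "p = q \<longleftrightarrow> (\<forall>i<n. p i = q i)"
    using p q unfolding unity_grid_def by (auto intro: PiE_ext)
  moreover have "(\<Sum>\<alpha>\<in>{..<n} \<rightarrow>\<^sub>E {..<m}. \<Prod>i<n. p i ^ \<alpha> i * q i ^ (m - \<alpha> i)) =
      (\<Prod>i<n. \<Sum>a<m. p i ^ a * q i ^ (m - a))"
    by (intro prod_sum_PiE[symmetric]) auto
  ultimately show ?thesis by (auto simp: factor intro: prod_zero)
qed

definition fourier_coeff :: "nat \<Rightarrow> nat \<Rightarrow> ((nat \<Rightarrow> 'k::field) \<Rightarrow> 'k) \<Rightarrow> (nat \<Rightarrow> nat) \<Rightarrow> 'k" where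
  "fourier_coeff m n h \<alpha> =
     inverse (of_nat m ^ n) * (\<Sum>q\<in>unity_grid m n. h q * (\<Prod>i<n. q i ^ (m - \<alpha> i)))"

lemma fourier_inversion:
  assumes m: "0 < m" and p: "p \<in> unity_grid m n"
  shows "(h p :: 'k::{alg_closed_field, field_char_0}) =
    (\<Sum>\<alpha>\<in>{..<n} \<rightarrow>\<^sub>E {..<m}. fourier_coeff m n h \<alpha> * (\<Prod>i<n. p i ^ \<alpha> i))"
proof -
  let ?A = "{..<n} \<rightarrow>\<^sub>E {..<m}" and ?G = "unity_grid m n :: (nat \<Rightarrow> 'k) set"
  have "(\<Sum>\<alpha>\<in>?A. fourier_coeff m n h \<alpha> * (\<Prod>i<n. p i ^ \<alpha> i)) =
      inverse (of_nat m ^ n) * (\<Sum>\<alpha>\<in>?A. \<Sum>q\<in>?G. h q * (\<Prod>i<n. p i ^ \<alpha> i * q i ^ (m - \<alpha> i)))"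
    by (simp add: fourier_coeff_def sum_distrib_left sum_distrib_right prod.distrib mult_ac)
  also have "(\<Sum>\<alpha>\<in>?A. \<Sum>q\<in>?G. h q * (\<Prod>i<n. p i ^ \<alpha> i * q i ^ (m - \<alpha> i))) =
      (\<Sum>q\<in>?G. h q * (\<Sum>\<alpha>\<in>?A. \<Prod>i<n. p i ^ \<alpha> i * q i ^ (m - \<alpha> i)))"
    by (subst sum.swap) (simp add: sum_distrib_left)
  also have "\<dots> = (\<Sum>q\<in>?G. if p = q then h q * of_nat m ^ n else 0)"
    by (intro sum.cong) (auto simp: sum_characters_at_pair[OF m p])
  also have "\<dots> = h p * of_nat m ^ n" using p m by simp
  finally show ?thesis using m by simp
qed

section \<open>Generic members of a family of systems of forms\<close>

text \<open>
  The induction is Gaussian elimination: one pivot is removed by passing to the Schur complement,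
  multiplied by the pivot in order to stay within polynomials, and only the roots of the pivot are
  lost.
\<close>

lemma finite_singular_parameters:
  fixes M :: "'i \<Rightarrow> 'i \<Rightarrow> 'k::field poly"
  assumes "finite I"
    and "\<And>i. i \<in> I \<Longrightarrow> poly (M i i) c\<^sub>0 \<noteq> 0"
    and "\<And>i j. i \<in> I \<Longrightarrow> j \<in> I \<Longrightarrow> i \<noteq> j \<Longrightarrow> poly (M i j) c\<^sub>0 = 0"
  shows "finite {c. \<exists>v. (\<forall>i\<in>I. (\<Sum>j\<in>I. poly (M i j) c * v j) = 0) \<and> (\<exists>i\<in>I. v i \<noteq> 0)}"
  using assms
proof (induction I arbitrary: M rule: finite_induct)
  case empty
  then show ?case by simp
next
  case (insert a I)
  define N where "N = (\<lambda>i j. M a a * M i j - M i a * M a j)"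
  let ?bad = "{c. \<exists>v. (\<forall>i\<in>I. (\<Sum>j\<in>I. poly (N i j) c * v j) = 0) \<and> (\<exists>i\<in>I. v i \<noteq> 0)}"
  have fin: "finite ?bad"
  proof (rule insert.IH)
    fix i assume "i \<in> I"
    moreover from this have "i \<noteq> a" using insert.hyps by auto
    ultimately show "poly (N i i) c\<^sub>0 \<noteq> 0"
      using insert.prems by (simp add: N_def)
  next
    fix i j assume "i \<in> I" "j \<in> I" "i \<noteq> j"
    moreover from this have "i \<noteq> a" "j \<noteq> a" using insert.hyps by auto
    ultimately show "poly (N i j) c\<^sub>0 = 0"
      using insert.prems by (simp add: N_def)
  qed
  have "M a a \<noteq> 0" using insert.prems(1)[of a] by auto
  then have fin': "finite {c. poly (M a a) c = 0}" by (rule poly_roots_finite)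
  have "c \<in> ?bad \<union> {c. poly (M a a) c = 0}"
    if v: "\<forall>i\<in>insert a I. (\<Sum>j\<in>insert a I. poly (M i j) c * v j) = 0"
      and nz: "\<exists>i\<in>insert a I. v i \<noteq> 0" for c v
  proof (cases "poly (M a a) c = 0")
    case False
    have row: "poly (M i a) c * v a + (\<Sum>j\<in>I. poly (M i j) c * v j) = 0" if "i \<in> insert a I" for i
      using v[rule_format, OF that] insert.hyps by simp
    have "(\<Sum>j\<in>I. poly (N i j) c * v j) = 0" if i: "i \<in> I" for i
    proof -
      have "(\<Sum>j\<in>I. poly (N i j) c * v j) =
          poly (M a a) c * (\<Sum>j\<in>I. poly (M i j) c * v j) - poly (M i a) c * (\<Sum>j\<in>I. poly (M a j) c * v j)"
        by (simp add: N_def algebra_simps sum_subtractf sum_distrib_left)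
      also have "\<dots> = poly (M a a) c * (poly (M i a) c * v a + (\<Sum>j\<in>I. poly (M i j) c * v j))
          - poly (M i a) c * (poly (M a a) c * v a + (\<Sum>j\<in>I. poly (M a j) c * v j))"
        by (simp add: algebra_simps)
      also have "\<dots> = 0" using row[of i] row[of a] i by simp
      finally show ?thesis .
    qed
    moreover have "\<exists>i\<in>I. v i \<noteq> 0"
    proof (rule ccontr)
      assume "\<not> (\<exists>i\<in>I. v i \<noteq> 0)"
      then have z: "\<forall>i\<in>I. v i = 0" by blast
      then have "poly (M a a) c * v a = 0" using row[of a] by simp
      then show False using False z nz by auto
    qed
    ultimately show ?thesis by blast
  qed auto
  then have "{c. \<exists>v. (\<forall>i\<in>insert a I. (\<Sum>j\<in>insert a I. poly (M i j) c * v j) = 0) \<and>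
      (\<exists>i\<in>insert a I. v i \<noteq> 0)} \<subseteq> ?bad \<union> {c. poly (M a a) c = 0}"
    by blast
  then show ?case using fin fin' by (meson finite_UnI finite_subset)
qed

text \<open>
  The exponents of the monomials of degree \<open>D\<close> in \<open>n\<close> variables form a finite set, because they are
  extensional functions; they index the rows and columns of the matrix in
  \<open>finite_parameters_with_common_zero\<close>.
\<close>

definition exponents :: "nat \<Rightarrow> nat \<Rightarrow> (nat \<Rightarrow> nat) set" where
  "exponents n D = {\<gamma> \<in> {..<n} \<rightarrow>\<^sub>E {..D}. (\<Sum>i<n. \<gamma> i) = D}"

definition monomial_fun :: "nat \<Rightarrow> (nat \<Rightarrow> nat) \<Rightarrow> (nat \<Rightarrow> 'k::comm_monoid_mult) \<Rightarrow> 'k" where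
  "monomial_fun n \<gamma> b = (\<Prod>i<n. b i ^ \<gamma> i)"

definition is_form :: "nat \<Rightarrow> nat \<Rightarrow> ((nat \<Rightarrow> 'k::field) \<Rightarrow> 'k) \<Rightarrow> bool" where
  "is_form n D \<phi> \<longleftrightarrow> (\<exists>a. \<forall>b. \<phi> b = (\<Sum>\<gamma>\<in>exponents n D. a \<gamma> * monomial_fun n \<gamma> b))"

lemma finite_exponents [simp]: "finite (exponents n D)"
  by (rule finite_subset[of _ "{..<n} \<rightarrow>\<^sub>E {..D}"]) (auto simp: exponents_def intro: finite_PiE)

lemma restrict_in_exponents:
  assumes "(\<Sum>i<n. \<gamma> i) = D"
  shows "restrict \<gamma> {..<n} \<in> exponents n D"
proof -
  have "\<gamma> i \<le> D" if "i < n" for i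
    using member_le_sum[of i "{..<n}" \<gamma>] assms that by simp
  then show ?thesis using assms by (auto simp: exponents_def)
qed

lemma monomial_fun_restrict [simp]: "monomial_fun n (restrict \<gamma> {..<n}) b = monomial_fun n \<gamma> b"
  by (auto simp: monomial_fun_def intro!: prod.cong)

lemma is_form_monomial_fun:
  assumes "(\<Sum>i<n. \<gamma> i) = D"
  shows "is_form n D (monomial_fun n \<gamma>)"
  unfolding is_form_def
  by (rule exI[of _ "\<lambda>\<delta>. if restrict \<gamma> {..<n} = \<delta> then 1 else 0"])
     (simp add: if_distribR sum.delta restrict_in_exponents[OF assms] if_distrib[of "\<lambda>x. x * _"] cong: if_cong)

lemma is_form_scale:
  assumes "is_form n D \<phi>"
  shows "is_form n D (\<lambda>b. s * \<phi> b)"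
proof -
  from assms obtain a where a: "\<And>b. \<phi> b = (\<Sum>\<gamma>\<in>exponents n D. a \<gamma> * monomial_fun n \<gamma> b)"
    by (auto simp: is_form_def)
  then show ?thesis unfolding is_form_def
    by (intro exI[of _ "\<lambda>\<gamma>. s * a \<gamma>"]) (simp add: sum_distrib_left mult.assoc)
qed

lemma is_form_sum:
  assumes "\<And>i. i \<in> A \<Longrightarrow> is_form n D (\<phi> i)"
  shows "is_form n D (\<lambda>b. \<Sum>i\<in>A. \<phi> i b)"
proof -
  from assms obtain a where "\<And>i b. i \<in> A \<Longrightarrow> \<phi> i b = (\<Sum>\<gamma>\<in>exponents n D. a i \<gamma> * monomial_fun n \<gamma> b)"
    unfolding is_form_def by metis
  then have "(\<Sum>i\<in>A. \<phi> i b) = (\<Sum>\<gamma>\<in>exponents n D. (\<Sum>i\<in>A. a i \<gamma>) * monomial_fun n \<gamma> b)" for b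
    by (simp add: sum_distrib_right sum.swap[of _ _ A])
  then show ?thesis unfolding is_form_def by (intro exI[of _ "\<lambda>\<gamma>. \<Sum>i\<in>A. a i \<gamma>"]) simp
qed

lemma is_form_mult:
  assumes "is_form n D \<phi>" "is_form n E \<psi>"
  shows "is_form n (D + E) (\<lambda>b. \<phi> b * \<psi> b)"
proof -
  from assms obtain a a' where a: "\<And>b. \<phi> b = (\<Sum>\<gamma>\<in>exponents n D. a \<gamma> * monomial_fun n \<gamma> b)"
    and a': "\<And>b. \<psi> b = (\<Sum>\<gamma>\<in>exponents n E. a' \<gamma> * monomial_fun n \<gamma> b)"
    by (auto simp: is_form_def)
  have "(\<lambda>b. \<phi> b * \<psi> b) = (\<lambda>b. \<Sum>\<gamma>\<in>exponents n D. \<Sum>\<delta>\<in>exponents n E.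
      (a \<gamma> * a' \<delta>) * monomial_fun n (\<lambda>i. \<gamma> i + \<delta> i) b)"
    by (simp only: a a' sum_product monomial_fun_def power_add prod.distrib) (simp only: mult_ac)
  moreover have "is_form n (D + E) \<dots>"
    by (intro is_form_sum is_form_scale is_form_monomial_fun) (auto simp: exponents_def sum.distrib)
  ultimately show ?thesis by simp
qed

lemma is_form_linear: "is_form n 1 (\<lambda>b. \<Sum>i<n. t i * b i)"
proof (rule is_form_sum)
  fix i assume i: "i \<in> {..<n}"
  have "monomial_fun n (\<lambda>j. if j = i then 1 else 0) = (\<lambda>b::nat \<Rightarrow> 'a. b i)"
    using i by (auto simp: monomial_fun_def if_distrib[of "\<lambda>x. _ ^ x"] prod.delta cong: if_cong)
  then show "is_form n 1 (\<lambda>b. t i * b i)"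
    using is_form_scale[OF is_form_monomial_fun[of "\<lambda>j. if j = i then 1 else 0" n 1], of "t i"] i
    by simp
qed

lemma is_form_power:
  assumes "is_form n D \<phi>"
  shows "is_form n (e * D) (\<lambda>b. \<phi> b ^ e)"
proof (induction e)
  case 0
  show ?case using is_form_monomial_fun[of "\<lambda>_. 0" n 0] by (simp add: monomial_fun_def[abs_def])
next
  case (Suc e)
  then show ?case using is_form_mult[OF assms] by simp
qed

text \<open>
  For the special parameter \<open>c\<^sub>0\<close> the forms are pure powers \<open>b\<^sub>i\<^sup>e\<close>, which have no common zero
  except the origin. Every monomial of degree \<open>n * e\<close> is divisible by one of these powers.
  Multiplying the \<open>i\<close>-th form by the quotient turns a common zero \<open>b\<close> into a kernel vector,
  consisting of the values at \<open>b\<close> of all monomials of that degree, of a square matrix that is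
  diagonal at \<open>c\<^sub>0\<close>. This is Macaulay's matrix for the resultant, and it stays regular for all but
  finitely many parameters.
\<close>

lemma finite_parameters_with_common_zero:
  fixes P :: "nat \<Rightarrow> 'p \<Rightarrow> 'k::field poly" and \<phi> :: "'p \<Rightarrow> (nat \<Rightarrow> 'k) \<Rightarrow> 'k"
  assumes "finite S"
    and form: "\<And>p. p \<in> S \<Longrightarrow> is_form n e (\<phi> p)"
    and \<kappa>: "\<kappa> \<noteq> 0"
    and special: "\<And>i b. i < n \<Longrightarrow> (\<Sum>p\<in>S. poly (P i p) c\<^sub>0 * \<phi> p b) = \<kappa> * b i ^ e"
  shows "finite {c. \<exists>b. (\<exists>i<n. b i \<noteq> 0) \<and> (\<forall>i<n. (\<Sum>p\<in>S. poly (P i p) c * \<phi> p b) = 0)}"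
proof (cases "n = 0")
  case False
  define D where "D = n * e"
  have "\<exists>i<n. e \<le> \<gamma> i" if "\<gamma> \<in> exponents n D" for \<gamma>
  proof (rule ccontr)
    assume "\<not> (\<exists>i<n. e \<le> \<gamma> i)"
    then have "(\<Sum>i<n. \<gamma> i) < (\<Sum>i<n. e)" using False by (intro sum_strict_mono) auto
    then show False using that by (simp add: exponents_def D_def)
  qed
  then obtain \<iota> where \<iota>: "\<And>\<gamma>. \<gamma> \<in> exponents n D \<Longrightarrow> \<iota> \<gamma> < n \<and> e \<le> \<gamma> (\<iota> \<gamma>)" by metis
  define rest where "rest = (\<lambda>\<gamma>. \<gamma>(\<iota> \<gamma> := \<gamma> (\<iota> \<gamma>) - e))"
  have split_exponents: "(\<Sum>i<n. \<gamma> i) = (\<Sum>i<n. rest \<gamma> i) + e"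
    and split_monomial: "monomial_fun n \<gamma> b = monomial_fun n (rest \<gamma>) b * b (\<iota> \<gamma>) ^ e"
    if \<gamma>: "\<gamma> \<in> exponents n D" for \<gamma> and b :: "nat \<Rightarrow> 'k"
  proof -
    have l: "\<iota> \<gamma> \<in> {..<n}" "e \<le> \<gamma> (\<iota> \<gamma>)" using \<iota>[OF \<gamma>] by auto
    have off: "rest \<gamma> i = \<gamma> i" if "i \<in> {..<n} - {\<iota> \<gamma>}" for i
      using that by (auto simp: rest_def)
    have on: "rest \<gamma> (\<iota> \<gamma>) + e = \<gamma> (\<iota> \<gamma>)" using l by (simp add: rest_def)
    show "(\<Sum>i<n. \<gamma> i) = (\<Sum>i<n. rest \<gamma> i) + e"
      using l(1) off on by (simp add: sum.remove[of "{..<n}" "\<iota> \<gamma>"])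
    show "monomial_fun n \<gamma> b = monomial_fun n (rest \<gamma>) b * b (\<iota> \<gamma>) ^ e"
      using l(1) off on[symmetric]
      by (simp add: monomial_fun_def prod.remove[of "{..<n}" "\<iota> \<gamma>"] power_add mult_ac)
  qed
  have "is_form n D (\<lambda>b. monomial_fun n (rest \<gamma>) b * \<phi> p b)"
    if \<gamma>: "\<gamma> \<in> exponents n D" and p: "p \<in> S" for \<gamma> p
  proof -
    have "(\<Sum>i<n. rest \<gamma> i) + e = D" using split_exponents[OF \<gamma>] \<gamma> by (simp add: exponents_def)
    then show ?thesis
      using is_form_mult[OF is_form_monomial_fun[OF refl] form[OF p], of "rest \<gamma>"] by simp
  qed
  then obtain a where a: "\<And>\<gamma> p b. \<gamma> \<in> exponents n D \<Longrightarrow> p \<in> S \<Longrightarrow>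
      monomial_fun n (rest \<gamma>) b * \<phi> p b = (\<Sum>\<delta>\<in>exponents n D. a \<gamma> p \<delta> * monomial_fun n \<delta> b)"
    unfolding is_form_def by metis
  \<comment> \<open>Splitting off the value at \<open>c\<^sub>0\<close> makes the matrix below \<open>\<kappa>\<close> times the identity at \<open>c\<^sub>0\<close> by
    construction.\<close>
  define Q where "Q = (\<lambda>i p. synthetic_div (P i p) c\<^sub>0)"
  have Q: "poly (P i p) c = poly (P i p) c\<^sub>0 + (c - c\<^sub>0) * poly (Q i p) c" for i p c
  proof -
    have "poly (P i p) c = poly ([:-c\<^sub>0, 1:] * Q i p + [:poly (P i p) c\<^sub>0:]) c"
      unfolding Q_def synthetic_div_correct' ..
    then show ?thesis by (simp add: algebra_simps)
  qed
  define M where "M = (\<lambda>\<gamma> \<delta>. [:if \<gamma> = \<delta> then \<kappa> else 0:] +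
      [:-c\<^sub>0, 1:] * (\<Sum>p\<in>S. smult (a \<gamma> p \<delta>) (Q (\<iota> \<gamma>) p)))"
  have "finite {c. \<exists>v. (\<forall>\<gamma>\<in>exponents n D. (\<Sum>\<delta>\<in>exponents n D. poly (M \<gamma> \<delta>) c * v \<delta>) = 0) \<and>
      (\<exists>\<gamma>\<in>exponents n D. v \<gamma> \<noteq> 0)}" (is "finite ?bad")
    by (rule finite_singular_parameters[of _ M c\<^sub>0]) (auto simp: M_def \<kappa>)
  moreover have "c \<in> ?bad" if b: "\<exists>i<n. b i \<noteq> 0"
    and zero: "\<forall>i<n. (\<Sum>p\<in>S. poly (P i p) c * \<phi> p b) = 0" for c b
  proof -
    have "(\<Sum>\<delta>\<in>exponents n D. poly (M \<gamma> \<delta>) c * monomial_fun n \<delta> b) = 0"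
      if \<gamma>: "\<gamma> \<in> exponents n D" for \<gamma>
    proof -
      let ?i = "\<iota> \<gamma>" and ?r = "monomial_fun n (rest \<gamma>) b"
      have "(\<Sum>\<delta>\<in>exponents n D. poly (M \<gamma> \<delta>) c * monomial_fun n \<delta> b) =
          \<kappa> * monomial_fun n \<gamma> b + (c - c\<^sub>0) * (\<Sum>\<delta>\<in>exponents n D. \<Sum>p\<in>S.
            poly (Q ?i p) c * (a \<gamma> p \<delta> * monomial_fun n \<delta> b))"
      proof -
        have "poly (M \<gamma> \<delta>) c * monomial_fun n \<delta> b =
            (if \<gamma> = \<delta> then \<kappa> * monomial_fun n \<delta> b else 0) +
            (c - c\<^sub>0) * (\<Sum>p\<in>S. poly (Q ?i p) c * (a \<gamma> p \<delta> * monomial_fun n \<delta> b))" for \<delta>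
        proof -
          have "poly (M \<gamma> \<delta>) c = (if \<gamma> = \<delta> then \<kappa> else 0) + (c - c\<^sub>0) * (\<Sum>p\<in>S. a \<gamma> p \<delta> * poly (Q ?i p) c)"
            by (simp add: M_def poly_sum algebra_simps)
          moreover have "(\<Sum>p\<in>S. a \<gamma> p \<delta> * poly (Q ?i p) c) * monomial_fun n \<delta> b =
              (\<Sum>p\<in>S. poly (Q ?i p) c * (a \<gamma> p \<delta> * monomial_fun n \<delta> b))"
            unfolding sum_distrib_right by (simp only: mult_ac)
          ultimately show ?thesis by (simp add: distrib_right mult.assoc)
        qed
        then show ?thesis using \<gamma>
          by (simp add: sum.distrib sum_distrib_left sum.delta)
      qed
      also have "(\<Sum>\<delta>\<in>exponents n D. \<Sum>p\<in>S. poly (Q ?i p) c * (a \<gamma> p \<delta> * monomial_fun n \<delta> b)) =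
          (\<Sum>p\<in>S. poly (Q ?i p) c * (?r * \<phi> p b))"
        by (subst sum.swap) (simp add: a[OF \<gamma>] sum_distrib_left)
      also have "\<kappa> * monomial_fun n \<gamma> b = ?r * (\<Sum>p\<in>S. poly (P ?i p) c\<^sub>0 * \<phi> p b)"
        using special[of ?i b] \<iota>[OF \<gamma>] by (simp add: split_monomial[OF \<gamma>])
      also have "\<dots> + (c - c\<^sub>0) * (\<Sum>p\<in>S. poly (Q ?i p) c * (?r * \<phi> p b)) =
          (\<Sum>p\<in>S. ?r * (poly (P ?i p) c\<^sub>0 * \<phi> p b) + (c - c\<^sub>0) * (poly (Q ?i p) c * (?r * \<phi> p b)))"
        by (simp only: sum_distrib_left sum.distrib)
      also have "\<dots> = (\<Sum>p\<in>S. ?r * (poly (P ?i p) c * \<phi> p b))"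
        by (simp only: Q[of _ _ c] algebra_simps)
      also have "\<dots> = ?r * (\<Sum>p\<in>S. poly (P ?i p) c * \<phi> p b)"
        by (simp only: sum_distrib_left)
      also have "\<dots> = 0" using zero \<iota>[OF \<gamma>] by simp
      finally show ?thesis .
    qed
    moreover have "\<exists>\<gamma>\<in>exponents n D. monomial_fun n \<gamma> b \<noteq> 0"
    proof -
      obtain i where i: "i < n" "b i \<noteq> 0" using b by blast
      let ?\<gamma> = "\<lambda>j. if j = i then D else 0"
      have "monomial_fun n ?\<gamma> b = b i ^ D"
        using i by (auto simp: monomial_fun_def if_distrib[of "\<lambda>x. _ ^ x"] prod.delta cong: if_cong)
      then have "monomial_fun n (restrict ?\<gamma> {..<n}) b \<noteq> 0" using i by simp
      moreover have "restrict ?\<gamma> {..<n} \<in> exponents n D" using i by (intro restrict_in_exponents) simp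
      ultimately show ?thesis by blast
    qed
    ultimately show ?thesis by (intro CollectI exI[of _ "\<lambda>\<delta>. monomial_fun n \<delta> b"]) blast
  qed
  ultimately show ?thesis
    by (elim finite_subset[rotated]) blast
qed simp

section \<open>Evaluation, grading and derivatives of polynomials\<close>

lemma poly_mapping_sum_single:
  "(p :: 'a \<Rightarrow>\<^sub>0 'b::comm_monoid_add) = (\<Sum>m\<in>Poly_Mapping.keys p. Poly_Mapping.single m (Poly_Mapping.lookup p m))"
proof (rule poly_mapping_eqI)
  fix k
  have "(\<Sum>m\<in>Poly_Mapping.keys p. Poly_Mapping.lookup (Poly_Mapping.single m (Poly_Mapping.lookup p m)) k) =
      (\<Sum>m\<in>Poly_Mapping.keys p. if m = k then Poly_Mapping.lookup p m else 0)"
    by (intro sum.cong) (auto simp: lookup_single when_def)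
  also have "\<dots> = Poly_Mapping.lookup p k" by (simp add: in_keys_iff)
  finally show "Poly_Mapping.lookup p k = Poly_Mapping.lookup (\<Sum>m\<in>Poly_Mapping.keys p. Poly_Mapping.single m (Poly_Mapping.lookup p m)) k"
    by (simp add: lookup_sum)
qed

lemma poly_mapping_induct_single [case_names zero single add]:
  fixes p :: "'a \<Rightarrow>\<^sub>0 'b::comm_monoid_add"
  assumes "P 0" "\<And>m c. P (Poly_Mapping.single m c)" "\<And>p q. P p \<Longrightarrow> P q \<Longrightarrow> P (p + q)"
  shows "P p"
proof -
  have "P (\<Sum>m\<in>A. Poly_Mapping.single m (f m))" if "finite A" for A :: "'a set" and f
    using that by (induction A rule: finite_induct) (auto intro: assms)
  then show ?thesis by (subst poly_mapping_sum_single) simp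
qed

definition monomial_value :: "(nat \<Rightarrow> 'k::comm_monoid_mult) \<Rightarrow> monomial \<Rightarrow> 'k" where
  "monomial_value a m = (\<Prod>i\<in>Poly_Mapping.keys m. a i ^ Poly_Mapping.lookup m i)"

lemma monomial_value_superset:
  assumes "finite A" "Poly_Mapping.keys m \<subseteq> A"
  shows "monomial_value a m = (\<Prod>i\<in>A. a i ^ Poly_Mapping.lookup m i)"
  unfolding monomial_value_def using assms
  by (intro prod.mono_neutral_left) (auto simp: in_keys_iff)

lemma monomial_value_add: "monomial_value a (m + m') = monomial_value a m * monomial_value a m'"
proof -
  let ?A = "Poly_Mapping.keys m \<union> Poly_Mapping.keys m'"
  have "Poly_Mapping.keys (m + m') \<subseteq> ?A" by (rule keys_add)
  then show ?thesis
    by (simp add: monomial_value_superset[of ?A] lookup_add power_add prod.distrib)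
qed

lemma eval_mpoly_superset:
  assumes "finite A" "Poly_Mapping.keys p \<subseteq> A"
  shows "eval_mpoly a p = (\<Sum>m\<in>A. Poly_Mapping.lookup p m * monomial_value a m)"
  unfolding eval_mpoly_def monomial_value_def[symmetric] using assms
  by (intro sum.mono_neutral_left) (auto simp: in_keys_iff)

lemma eval_mpoly_single: "eval_mpoly a (Poly_Mapping.single m c) = c * monomial_value a m"
  by (subst eval_mpoly_superset[of "{m}"]) auto

lemma eval_mpoly_0 [simp]: "eval_mpoly a 0 = 0"
  by (simp add: eval_mpoly_def)

lemma eval_mpoly_add [simp]: "eval_mpoly a (p + q) = eval_mpoly a p + eval_mpoly a q"
proof -
  let ?A = "Poly_Mapping.keys p \<union> Poly_Mapping.keys q"
  have "Poly_Mapping.keys (p + q) \<subseteq> ?A" by (rule keys_add)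
  then show ?thesis
    by (simp add: eval_mpoly_superset[of ?A] lookup_add distrib_right sum.distrib)
qed

lemma eval_mpoly_sum [simp]: "eval_mpoly a (\<Sum>i\<in>A. p i) = (\<Sum>i\<in>A. eval_mpoly a (p i))"
  by (induction A rule: infinite_finite_induct) auto

lemma eval_mpoly_mult [simp]: "eval_mpoly a (p * q) = eval_mpoly a p * eval_mpoly a q"
proof (induction p rule: poly_mapping_induct_single)
  case (single m c)
  show ?case
    by (induction q rule: poly_mapping_induct_single)
       (simp_all add: mult_single eval_mpoly_single monomial_value_add distrib_left distrib_right mult_ac)
qed (simp_all add: distrib_right)

lemma eval_mpoly_1 [simp]: "eval_mpoly a 1 = 1"
  using eval_mpoly_single[of a 0 1] by (simp add: monomial_value_def)

lemma eval_mpoly_power [simp]: "eval_mpoly a (p ^ j) = eval_mpoly a p ^ j"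
  by (induction j) auto

lemma eval_mpoly_scale [simp]: "eval_mpoly a (scale_mpoly c p) = c * eval_mpoly a p"
  by (simp add: scale_mpoly_def eval_mpoly_single monomial_value_def)

lemma eval_mpoly_diff [simp]: "eval_mpoly a (p - q) = eval_mpoly a p - eval_mpoly a q"
  using eval_mpoly_add[of a "p - q" q] by simp

lemma eval_mpoly_cong:
  assumes "p \<in> poly_ring n" "\<And>i. i < n \<Longrightarrow> a i = b i"
  shows "eval_mpoly a p = eval_mpoly b p"
  unfolding eval_mpoly_def using assms
  by (intro sum.cong refl arg_cong[where f = "\<lambda>x. _ * x"] prod.cong) (force simp: poly_ring_def)+

lemma partial_deriv_superset:
  assumes "finite A" "Poly_Mapping.keys p \<subseteq> A"
  shows "partial_deriv i p = (\<Sum>m\<in>A. Poly_Mapping.single (m - Poly_Mapping.single i 1)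
           (of_nat (Poly_Mapping.lookup m i) * Poly_Mapping.lookup p m))"
  unfolding partial_deriv_def using assms
  by (intro sum.mono_neutral_left) (auto simp: in_keys_iff)

lemma partial_deriv_single:
  "partial_deriv i (Poly_Mapping.single m c) =
     Poly_Mapping.single (m - Poly_Mapping.single i 1) (of_nat (Poly_Mapping.lookup m i) * c)"
  by (subst partial_deriv_superset[of "{m}"]) auto

lemma partial_deriv_0 [simp]: "partial_deriv i 0 = 0"
  by (simp add: partial_deriv_def)

lemma partial_deriv_add: "partial_deriv i (p + q) = partial_deriv i p + partial_deriv i q"
proof -
  let ?A = "Poly_Mapping.keys p \<union> Poly_Mapping.keys q"
  have "Poly_Mapping.keys (p + q) \<subseteq> ?A" by (rule keys_add)
  then show ?thesis
    by (simp add: partial_deriv_superset[of ?A] lookup_add distrib_left single_add sum.distrib)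
qed

lemma partial_deriv_sum: "partial_deriv i (\<Sum>j\<in>A. p j) = (\<Sum>j\<in>A. partial_deriv i (p j))"
  by (induction A rule: infinite_finite_induct) (auto simp: partial_deriv_add)

lemma single_diff_exponent_add:
  "Poly_Mapping.single (m - Poly_Mapping.single i 1 + m' :: monomial) (of_nat (Poly_Mapping.lookup m i) * c) =
   Poly_Mapping.single (m + m' - Poly_Mapping.single i 1) (of_nat (Poly_Mapping.lookup m i) * c :: 'k::field)"
proof (cases "Poly_Mapping.lookup m i = 0")
  case False
  then have "m - Poly_Mapping.single i 1 + m' = m + m' - Poly_Mapping.single i 1"
    by (intro poly_mapping_eqI) (auto simp: lookup_add lookup_minus lookup_single when_def)
  then show ?thesis by simp
qed simp

lemma partial_deriv_mult:
  "partial_deriv i (p * q) = partial_deriv i p * q + p * partial_deriv i q"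
proof (induction p rule: poly_mapping_induct_single)
  case (single m c)
  show ?case
  proof (induction q rule: poly_mapping_induct_single)
    case (single m' c')
    have "partial_deriv i (Poly_Mapping.single m c * Poly_Mapping.single m' c') =
        Poly_Mapping.single (m + m' - Poly_Mapping.single i 1) (of_nat (Poly_Mapping.lookup m i) * (c * c')) +
        Poly_Mapping.single (m' + m - Poly_Mapping.single i 1) (of_nat (Poly_Mapping.lookup m' i) * (c * c'))"
      by (simp add: mult_single partial_deriv_single lookup_add single_add[symmetric] algebra_simps)
    also have "\<dots> = partial_deriv i (Poly_Mapping.single m c) * Poly_Mapping.single m' c' +
        Poly_Mapping.single m c * partial_deriv i (Poly_Mapping.single m' c')"
      unfolding single_diff_exponent_add[symmetric]
      by (simp add: partial_deriv_single mult_single mult_ac add_ac)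
    finally show ?case .
  qed (simp_all add: partial_deriv_add distrib_left add_ac)
qed (simp_all add: partial_deriv_add distrib_right add_ac)

lemma partial_deriv_scale: "partial_deriv i (scale_mpoly c p) = scale_mpoly c (partial_deriv i p)"
  by (simp add: scale_mpoly_def partial_deriv_mult partial_deriv_single)

lemma partial_deriv_power_Suc:
  "partial_deriv i (p ^ Suc j) = of_nat (Suc j) * p ^ j * partial_deriv i p"
proof (induction j)
  case (Suc j)
  have "partial_deriv i (p ^ Suc (Suc j)) = partial_deriv i p * p ^ Suc j + p * partial_deriv i (p ^ Suc j)"
    by (subst power_Suc, subst partial_deriv_mult) simp
  then show ?case unfolding Suc.IH by (simp add: algebra_simps)
qed simp

section \<open>The polynomial ring and its graded pieces\<close>

lemma poly_ring_0 [simp]: "0 \<in> poly_ring n"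
  by (simp add: poly_ring_def)

lemma poly_ring_1 [simp]: "1 \<in> poly_ring n"
  by (simp add: poly_ring_def)

lemma poly_ring_single: "Poly_Mapping.keys m \<subseteq> {..<n} \<Longrightarrow> Poly_Mapping.single m c \<in> poly_ring n"
  by (simp add: poly_ring_def)

lemma poly_ring_add: "p \<in> poly_ring n \<Longrightarrow> q \<in> poly_ring n \<Longrightarrow> p + q \<in> poly_ring n"
  using keys_add[of p q] unfolding poly_ring_def by blast

lemma poly_ring_mult: "p \<in> poly_ring n \<Longrightarrow> q \<in> poly_ring n \<Longrightarrow> p * q \<in> poly_ring n"
proof -
  assume pq: "p \<in> poly_ring n" "q \<in> poly_ring n"
  have "Poly_Mapping.keys m \<subseteq> {..<n}" if m: "m \<in> Poly_Mapping.keys (p * q)" for m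
  proof -
    obtain a b where "m = a + b" "a \<in> Poly_Mapping.keys p" "b \<in> Poly_Mapping.keys q"
      using m keys_mult[of p q] by blast
    then show ?thesis using pq keys_add[of a b] unfolding poly_ring_def by blast
  qed
  then show ?thesis by (simp add: poly_ring_def)
qed

lemma poly_ring_uminus: "p \<in> poly_ring n \<Longrightarrow> - p \<in> poly_ring n"
  by (simp add: poly_ring_def)

lemma poly_ring_diff: "p \<in> poly_ring n \<Longrightarrow> q \<in> poly_ring n \<Longrightarrow> p - q \<in> poly_ring n"
  using poly_ring_add[of p n "- q"] poly_ring_uminus[of q n] by simp

lemma poly_ring_power: "p \<in> poly_ring n \<Longrightarrow> p ^ j \<in> poly_ring n"
  by (induction j) (auto intro: poly_ring_mult)

lemma poly_ring_prod: "(\<And>i. i \<in> A \<Longrightarrow> p i \<in> poly_ring n) \<Longrightarrow> (\<Prod>i\<in>A. p i) \<in> poly_ring n"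
  by (induction A rule: infinite_finite_induct) (auto intro: poly_ring_mult)

lemma monomial_degree_superset:
  assumes "finite A" "Poly_Mapping.keys m \<subseteq> A"
  shows "monomial_degree m = (\<Sum>i\<in>A. Poly_Mapping.lookup m i)"
  unfolding monomial_degree_def using assms
  by (intro sum.mono_neutral_left) (auto simp: in_keys_iff)

lemma monomial_degree_add [simp]: "monomial_degree (m + m') = monomial_degree m + monomial_degree m'"
proof -
  let ?A = "Poly_Mapping.keys m \<union> Poly_Mapping.keys m'"
  have "Poly_Mapping.keys (m + m') \<subseteq> ?A" by (rule keys_add)
  then show ?thesis
    by (simp add: monomial_degree_superset[of ?A] lookup_add sum.distrib)
qed

lemma monomial_degree_0 [simp]: "monomial_degree 0 = 0"
  by (simp add: monomial_degree_def)

lemma graded_piece_poly_ring: "p \<in> graded_piece n e \<Longrightarrow> p \<in> poly_ring n"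
  by (simp add: graded_piece_def)

lemma graded_piece_0 [simp]: "0 \<in> graded_piece n e"
  by (simp add: graded_piece_def)

lemma graded_piece_1 [simp]: "1 \<in> graded_piece n 0"
  by (simp add: graded_piece_def)

lemma graded_piece_single:
  "Poly_Mapping.keys m \<subseteq> {..<n} \<Longrightarrow> monomial_degree m = e \<Longrightarrow> Poly_Mapping.single m c \<in> graded_piece n e"
  by (simp add: graded_piece_def poly_ring_def)

lemma graded_piece_add: "p \<in> graded_piece n e \<Longrightarrow> q \<in> graded_piece n e \<Longrightarrow> p + q \<in> graded_piece n e"
  using keys_add[of p q] unfolding graded_piece_def by (blast intro: poly_ring_add)

lemma graded_piece_mult:
  assumes "p \<in> graded_piece n e" "q \<in> graded_piece n e'"
  shows "p * q \<in> graded_piece n (e + e')"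
  using assms keys_mult[of p q] unfolding graded_piece_def
  by (fastforce intro: poly_ring_mult)

lemma graded_piece_scale: "p \<in> graded_piece n e \<Longrightarrow> scale_mpoly c p \<in> graded_piece n e"
  using graded_piece_mult[of "Poly_Mapping.single 0 c" n 0 p e]
  unfolding scale_mpoly_def by (simp add: graded_piece_single)

lemma scale_mpoly_minus_one: "scale_mpoly (-1) p = - p"
  unfolding scale_mpoly_def single_uminus by simp

lemma graded_piece_diff: "p \<in> graded_piece n e \<Longrightarrow> q \<in> graded_piece n e \<Longrightarrow> p - q \<in> graded_piece n e"
  using graded_piece_add[of p n e "- q"] graded_piece_scale[of q n e "-1"]
  by (simp add: scale_mpoly_minus_one)

lemma graded_piece_power:
  assumes "p \<in> graded_piece n e"
  shows "p ^ j \<in> graded_piece n (j * e)"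
  by (induction j) (use assms graded_piece_mult in \<open>auto simp: add.commute\<close>)

lemma graded_piece_sum:
  "(\<And>i. i \<in> A \<Longrightarrow> p i \<in> graded_piece n e) \<Longrightarrow> (\<Sum>i\<in>A. p i) \<in> graded_piece n e"
  by (induction A rule: infinite_finite_induct) (auto intro: graded_piece_add)

lemma eval_mpoly_homogeneous:
  assumes "p \<in> graded_piece n e"
  shows "eval_mpoly (\<lambda>i. t * a i) p = t ^ e * eval_mpoly a p"
proof -
  have "monomial_value (\<lambda>i. t * a i) m = t ^ monomial_degree m * monomial_value a m" for m
    by (simp add: monomial_value_def monomial_degree_def power_mult_distrib prod.distrib power_sum)
  then show ?thesis using assms
    unfolding eval_mpoly_def monomial_value_def[symmetric] graded_piece_def
    by (simp add: sum_distrib_left mult_ac)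
qed

section \<open>Variables and linear forms\<close>

definition var :: "nat \<Rightarrow> 'k::field mpoly" where
  "var i = Poly_Mapping.single (Poly_Mapping.single i 1) 1"

lemma var_graded: "i < n \<Longrightarrow> var i \<in> graded_piece n 1"
  unfolding var_def by (intro graded_piece_single) (auto simp: monomial_degree_def)

lemma var_poly_ring: "i < n \<Longrightarrow> var i \<in> poly_ring n"
  using var_graded graded_piece_poly_ring by blast

lemma eval_var [simp]: "eval_mpoly a (var i) = a i"
  by (simp add: var_def eval_mpoly_single monomial_value_def)

lemma partial_deriv_var: "partial_deriv i (var j) = (if i = j then 1 else 0)"
  by (auto simp: var_def partial_deriv_single lookup_single)

lemma var_power: "var i ^ j = Poly_Mapping.single (Poly_Mapping.single i j) 1"
proof (induction j)
  case (Suc j)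
  have "Poly_Mapping.single i 1 + Poly_Mapping.single i j = Poly_Mapping.single i (Suc j)"
    by (simp add: single_add[symmetric])
  then show ?case using Suc by (simp add: var_def mult_single)
qed simp

lemma single_eq_prod_vars:
  assumes "Poly_Mapping.keys m \<subseteq> {..<n}"
  shows "Poly_Mapping.single m 1 = (\<Prod>i<n. var i ^ Poly_Mapping.lookup m i)"
proof -
  have prod_single: "(\<Prod>i\<in>A. Poly_Mapping.single (f i) 1) = Poly_Mapping.single (\<Sum>i\<in>A. f i) (1 :: 'a)"
    for A :: "nat set" and f :: "nat \<Rightarrow> monomial"
    by (induction A rule: infinite_finite_induct) (auto simp: mult_single)
  have "m = (\<Sum>i\<in>Poly_Mapping.keys m. Poly_Mapping.single i (Poly_Mapping.lookup m i))"
    by (rule poly_mapping_sum_single)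
  also have "\<dots> = (\<Sum>i<n. Poly_Mapping.single i (Poly_Mapping.lookup m i))"
    using assms by (intro sum.mono_neutral_left) (auto simp: in_keys_iff)
  finally show ?thesis by (simp add: var_power prod_single)
qed

lemma linear_form_cases:
  assumes "l \<in> graded_piece n 1"
  shows "\<exists>a. l = (\<Sum>i<n. scale_mpoly (a i) (var i))"
proof -
  have keys: "\<exists>i<n. m = Poly_Mapping.single i 1" if m: "m \<in> Poly_Mapping.keys l" for m
  proof -
    have sub: "Poly_Mapping.keys m \<subseteq> {..<n}" and deg: "monomial_degree m = 1"
      using assms m by (auto simp: graded_piece_def poly_ring_def)
    have s: "(\<Sum>i<n. Poly_Mapping.lookup m i) = 1"
      using deg monomial_degree_superset[OF _ sub] by simp
    then obtain i where i: "i < n" "Poly_Mapping.lookup m i = 1"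
        "\<forall>j<n. j \<noteq> i \<longrightarrow> Poly_Mapping.lookup m j = 0"
      using sum_eq_1_iff[of "{..<n}" "Poly_Mapping.lookup m"] by auto
    have "m = Poly_Mapping.single i 1"
    proof (rule poly_mapping_eqI)
      fix j
      show "Poly_Mapping.lookup m j = Poly_Mapping.lookup (Poly_Mapping.single i 1) j"
        using i sub by (cases "j < n") (auto simp: lookup_single when_def in_keys_iff)
    qed
    then show ?thesis using i(1) by blast
  qed
  have "l = (\<Sum>m\<in>Poly_Mapping.keys l. Poly_Mapping.single m (Poly_Mapping.lookup l m))"
    by (rule poly_mapping_sum_single)
  also have "\<dots> = (\<Sum>m\<in>(\<lambda>i. Poly_Mapping.single i 1) ` {..<n}. Poly_Mapping.single m (Poly_Mapping.lookup l m))"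
    using keys by (intro sum.mono_neutral_left) (auto simp: in_keys_iff)
  also have "\<dots> = (\<Sum>i<n. Poly_Mapping.single (Poly_Mapping.single i 1) (Poly_Mapping.lookup l (Poly_Mapping.single i 1)))"
    by (subst sum.reindex) (auto simp: inj_on_def dest!: arg_cong[where f = Poly_Mapping.keys])
  also have "\<dots> = (\<Sum>i<n. scale_mpoly (Poly_Mapping.lookup l (Poly_Mapping.single i 1)) (var i))"
    by (simp add: scale_mpoly_def var_def mult_single)
  finally show ?thesis by (intro exI[of _ "\<lambda>i. Poly_Mapping.lookup l (Poly_Mapping.single i 1)"])
qed

section \<open>Homogeneous polynomials on the grid\<close>

lemma monomial_value_poly_ring:
  "Poly_Mapping.keys \<mu> \<subseteq> {..<n} \<Longrightarrow> monomial_value a \<mu> = (\<Prod>i<n. a i ^ Poly_Mapping.lookup \<mu> i)"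
  by (rule monomial_value_superset) auto

lemma dvd_add_complement_iff:
  fixes b m \<mu> :: nat
  assumes "b < m"
  shows "m dvd \<mu> + (m - b) \<longleftrightarrow> \<mu> mod m = b"
proof -
  define r where "r = \<mu> mod m"
  have r: "r < m" using assms by (simp add: r_def)
  have "m dvd \<mu> + (m - b) \<longleftrightarrow> m dvd r + (m - b)"
    unfolding r_def by (simp add: dvd_eq_mod_eq_0 mod_add_left_eq)
  also have "\<dots> \<longleftrightarrow> r = b"
  proof
    assume "m dvd r + (m - b)"
    then obtain k where k: "r + (m - b) = m * k" by (elim dvdE)
    have "m * k < m * 2" "0 < m * k" using k r assms by linarith+
    then have "k = 1" by auto
    then show "r = b" using k assms by simp
  qed (use assms in simp)
  finally show ?thesis by (simp add: r_def)
qed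

lemma fourier_sum_eval_mpoly:
  fixes g :: "'k::{alg_closed_field, field_char_0} mpoly"
  assumes m: "0 < m" and g: "g \<in> poly_ring n" and \<beta>: "\<And>i. i < n \<Longrightarrow> \<beta> i < m"
  shows "(\<Sum>p\<in>unity_grid m n. eval_mpoly p g * (\<Prod>i<n. p i ^ (m - \<beta> i))) =
    of_nat m ^ n * (\<Sum>\<mu> | \<mu> \<in> Poly_Mapping.keys g \<and> (\<forall>i<n. Poly_Mapping.lookup \<mu> i mod m = \<beta> i).
      Poly_Mapping.lookup g \<mu>)"
proof -
  let ?K = "Poly_Mapping.keys g" and ?G = "unity_grid m n :: (nat \<Rightarrow> 'k) set"
  have "(\<Sum>p\<in>?G. eval_mpoly p g * (\<Prod>i<n. p i ^ (m - \<beta> i))) =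
      (\<Sum>p\<in>?G. \<Sum>\<mu>\<in>?K. Poly_Mapping.lookup g \<mu> * (\<Prod>i<n. p i ^ (Poly_Mapping.lookup \<mu> i + (m - \<beta> i))))"
  proof (rule sum.cong[OF refl])
    fix p
    show "eval_mpoly p g * (\<Prod>i<n. p i ^ (m - \<beta> i)) =
        (\<Sum>\<mu>\<in>?K. Poly_Mapping.lookup g \<mu> * (\<Prod>i<n. p i ^ (Poly_Mapping.lookup \<mu> i + (m - \<beta> i))))"
      unfolding eval_mpoly_superset[OF finite_keys order_refl] sum_distrib_right
    proof (rule sum.cong[OF refl])
      fix \<mu> assume "\<mu> \<in> ?K"
      then have "Poly_Mapping.keys \<mu> \<subseteq> {..<n}" using g by (auto simp: poly_ring_def)
      then show "Poly_Mapping.lookup g \<mu> * monomial_value p \<mu> * (\<Prod>i<n. p i ^ (m - \<beta> i)) =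
          Poly_Mapping.lookup g \<mu> * (\<Prod>i<n. p i ^ (Poly_Mapping.lookup \<mu> i + (m - \<beta> i)))"
        by (simp add: monomial_value_poly_ring power_add prod.distrib mult.assoc)
    qed
  qed
  also have "\<dots> = (\<Sum>\<mu>\<in>?K. Poly_Mapping.lookup g \<mu> *
      (\<Sum>p\<in>?G. \<Prod>i<n. p i ^ (Poly_Mapping.lookup \<mu> i + (m - \<beta> i))))"
    by (subst sum.swap) (simp add: sum_distrib_left)
  also have "\<dots> = (\<Sum>\<mu>\<in>?K. if \<forall>i<n. Poly_Mapping.lookup \<mu> i mod m = \<beta> i
      then of_nat m ^ n * Poly_Mapping.lookup g \<mu> else 0)"
  proof (rule sum.cong[OF refl])
    fix \<mu>
    have iff: "(\<forall>i<n. m dvd Poly_Mapping.lookup \<mu> i + (m - \<beta> i)) \<longleftrightarrow>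
        (\<forall>i<n. Poly_Mapping.lookup \<mu> i mod m = \<beta> i)"
      using dvd_add_complement_iff \<beta> by metis
    show "Poly_Mapping.lookup g \<mu> * (\<Sum>p\<in>?G. \<Prod>i<n. p i ^ (Poly_Mapping.lookup \<mu> i + (m - \<beta> i))) =
        (if \<forall>i<n. Poly_Mapping.lookup \<mu> i mod m = \<beta> i
         then of_nat m ^ n * Poly_Mapping.lookup g \<mu> else 0)"
      unfolding sum_unity_grid_monomial[OF m] iff by auto
  qed
  also have "\<dots> = of_nat m ^ n * (\<Sum>\<mu> | \<mu> \<in> ?K \<and> (\<forall>i<n. Poly_Mapping.lookup \<mu> i mod m = \<beta> i).
      Poly_Mapping.lookup g \<mu>)"
    by (simp add: sum.inter_filter[symmetric] sum_distrib_left)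
  finally show ?thesis .
qed

text \<open>
  The coefficients of a polynomial with all exponents less than \<open>M\<close> are its Fourier coefficients
  on the grid of \<open>M\<close>-th roots of unity.
\<close>

lemma zero_if_vanishing:
  fixes g :: "'k::{alg_closed_field, field_char_0} mpoly"
  assumes n: "0 < n" and g: "g \<in> poly_ring n"
    and zero: "\<And>a. \<exists>i<n. a i \<noteq> 0 \<Longrightarrow> eval_mpoly a g = 0"
  shows "g = 0"
proof (rule poly_mapping_eqI)
  fix \<mu>
  define M where "M = Suc (\<Sum>\<nu>\<in>Poly_Mapping.keys g. \<Sum>i<n. Poly_Mapping.lookup \<nu> i)"
  have M: "Poly_Mapping.lookup \<nu> i < M" if "\<nu> \<in> Poly_Mapping.keys g" "i < n" for \<nu> i
  proof -
    have "Poly_Mapping.lookup \<nu> i \<le> (\<Sum>i<n. Poly_Mapping.lookup \<nu> i)"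
      using that by (intro member_le_sum) auto
    also have "\<dots> \<le> (\<Sum>\<nu>\<in>Poly_Mapping.keys g. \<Sum>i<n. Poly_Mapping.lookup \<nu> i)"
      using that by (intro member_le_sum[of \<nu> _ "\<lambda>\<nu>. \<Sum>i<n. Poly_Mapping.lookup \<nu> i"]) auto
    finally show ?thesis by (simp add: M_def)
  qed
  show "Poly_Mapping.lookup g \<mu> = Poly_Mapping.lookup 0 \<mu>"
  proof (cases "\<mu> \<in> Poly_Mapping.keys g")
    case True
    have same: "\<nu> = \<mu>" if \<nu>: "\<nu> \<in> Poly_Mapping.keys g"
      and eq: "\<forall>i<n. Poly_Mapping.lookup \<nu> i mod M = Poly_Mapping.lookup \<mu> i" for \<nu>
    proof (rule poly_mapping_eqI)
      fix i
      have "Poly_Mapping.keys \<nu> \<subseteq> {..<n}" "Poly_Mapping.keys \<mu> \<subseteq> {..<n}"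
        using g \<nu> True by (auto simp: poly_ring_def)
      then have "i \<notin> Poly_Mapping.keys \<nu>" "i \<notin> Poly_Mapping.keys \<mu>" if "\<not> i < n"
        using that by auto
      then show "Poly_Mapping.lookup \<nu> i = Poly_Mapping.lookup \<mu> i"
        using eq M[OF \<nu>] by (cases "i < n") (auto simp: in_keys_iff)
    qed
    then have set: "{\<nu>. \<nu> \<in> Poly_Mapping.keys g \<and> (\<forall>i<n. Poly_Mapping.lookup \<nu> i mod M = Poly_Mapping.lookup \<mu> i)} = {\<mu>}"
      using True M[OF True] by auto
    have "0 < M" by (simp add: M_def)
    have "p 0 \<noteq> 0" if p: "p \<in> unity_grid M n" for p :: "nat \<Rightarrow> 'k"
      using unity_grid_power[OF p n] \<open>0 < M\<close> by (auto simp: power_0_left)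
    then have "eval_mpoly p g = 0" if "p \<in> unity_grid M n" for p
      using that n zero by blast
    then have "of_nat M ^ n * Poly_Mapping.lookup g \<mu> = 0"
      using fourier_sum_eval_mpoly[of M g n "Poly_Mapping.lookup \<mu>"] g M[OF True]
        \<open>0 < M\<close> unfolding set by simp
    then show ?thesis using \<open>0 < M\<close> by simp
  qed (simp add: in_keys_iff)
qed

definition ideal_of_poly_ring :: "nat \<Rightarrow> 'k::field mpoly set \<Rightarrow> bool" where
  "ideal_of_poly_ring n J \<longleftrightarrow> 0 \<in> J \<and> (\<forall>p\<in>J. \<forall>q\<in>J. p + q \<in> J) \<and> (\<forall>q\<in>poly_ring n. \<forall>p\<in>J. q * p \<in> J)"

lemma
  assumes "ideal_of_poly_ring n J"
  shows ideal_zero: "0 \<in> J"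
    and ideal_add: "p \<in> J \<Longrightarrow> q \<in> J \<Longrightarrow> p + q \<in> J"
    and ideal_mult: "r \<in> poly_ring n \<Longrightarrow> p \<in> J \<Longrightarrow> r * p \<in> J"
    and ideal_scale: "p \<in> J \<Longrightarrow> scale_mpoly t p \<in> J"
    and ideal_diff: "p \<in> J \<Longrightarrow> q \<in> J \<Longrightarrow> p - q \<in> J"
    and ideal_sum: "(\<And>i. i \<in> A \<Longrightarrow> P i \<in> J) \<Longrightarrow> sum P A \<in> J"
proof -
  show zero: "0 \<in> J" using assms by (simp add: ideal_of_poly_ring_def)
  show add: "p \<in> J \<Longrightarrow> q \<in> J \<Longrightarrow> p + q \<in> J" for p q
    using assms by (simp add: ideal_of_poly_ring_def)
  show mult: "r \<in> poly_ring n \<Longrightarrow> p \<in> J \<Longrightarrow> r * p \<in> J" for r p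
    using assms by (simp add: ideal_of_poly_ring_def)
  show scale: "p \<in> J \<Longrightarrow> scale_mpoly t p \<in> J" for t p
    unfolding scale_mpoly_def by (intro mult poly_ring_single) auto
  show "p - q \<in> J" if "p \<in> J" "q \<in> J"
    using add[OF that(1) scale[OF that(2), of "-1"]] by (simp add: scale_mpoly_minus_one)
  show "sum P A \<in> J" if "\<And>i. i \<in> A \<Longrightarrow> P i \<in> J"
    using that by (induction A rule: infinite_finite_induct) (auto intro: zero add)
qed

lemma ideal_congruence_mult:
  assumes J: "ideal_of_poly_ring n J" and "a - a' \<in> J" "b - b' \<in> J" "a' \<in> poly_ring n" "b \<in> poly_ring n"
  shows "a * b - a' * b' \<in> J"
proof -
  have "a * b - a' * b' = b * (a - a') + a' * (b - b')" by (simp add: algebra_simps)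
  then show ?thesis using assms by (auto intro!: ideal_add[OF J] ideal_mult[OF J])
qed

lemma ideal_congruence_power:
  assumes J: "ideal_of_poly_ring n J" and "a - a' \<in> J" "a \<in> poly_ring n" "a' \<in> poly_ring n"
  shows "a ^ j - a' ^ j \<in> J"
proof (induction j)
  case (Suc j)
  then show ?case
    using ideal_congruence_mult[OF J assms(2) Suc.IH assms(4)] assms by (simp add: poly_ring_power)
qed (simp add: ideal_zero[OF J])

lemma ideal_congruence_prod:
  assumes J: "ideal_of_poly_ring n J" and "finite A"
    and "\<And>i. i \<in> A \<Longrightarrow> a i - a' i \<in> J \<and> a i \<in> poly_ring n \<and> a' i \<in> poly_ring n"
  shows "(\<Prod>i\<in>A. a i) - (\<Prod>i\<in>A. a' i) \<in> J"
  using assms(2,3)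
proof (induction A rule: finite_induct)
  case (insert i A)
  then show ?case
    using ideal_congruence_mult[OF J, of "a i" "a' i" "prod a A" "prod a' A"]
    by (simp add: poly_ring_prod)
qed (simp add: ideal_zero[OF J])

text \<open>
  The normal form, modulo the relations \<open>x\<^sub>i\<^sup>m = x\<^sub>0\<^sup>m\<close>, of a monomial of degree \<open>e\<close> with exponents
  congruent to \<open>\<rho>\<close>.
\<close>

definition standard_monomial :: "nat \<Rightarrow> nat \<Rightarrow> (nat \<Rightarrow> nat) \<Rightarrow> 'k::field mpoly" where
  "standard_monomial n e \<rho> = (\<Prod>i<n. var i ^ \<rho> i) * var 0 ^ (e - (\<Sum>i<n. \<rho> i))"

lemma monomial_congruent_standard:
  fixes J :: "'k::field mpoly set"
  assumes J: "ideal_of_poly_ring n J" and n: "0 < n"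
    and rel: "\<And>i. i < n \<Longrightarrow> var i ^ m - var 0 ^ m \<in> J"
    and \<mu>: "Poly_Mapping.keys \<mu> \<subseteq> {..<n}" "monomial_degree \<mu> = e"
  shows "Poly_Mapping.single \<mu> 1 - standard_monomial n e (\<lambda>i. Poly_Mapping.lookup \<mu> i mod m) \<in> J"
proof -
  let ?l = "Poly_Mapping.lookup \<mu>"
  have "(\<Prod>i<n. (var i ^ m) ^ (?l i div m)) - (\<Prod>i<n. (var 0 ^ m) ^ (?l i div m)) \<in> J"
    using n
    by (intro ideal_congruence_prod[OF J] conjI ideal_congruence_power[OF J rel] poly_ring_power var_poly_ring) auto
  then have "(\<Prod>i<n. var i ^ (?l i mod m)) * ((\<Prod>i<n. (var i ^ m) ^ (?l i div m)) - (\<Prod>i<n. (var 0 ^ m) ^ (?l i div m))) \<in> J"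
    by (intro ideal_mult[OF J] poly_ring_prod poly_ring_power var_poly_ring) auto
  moreover have "(\<Prod>i<n. var i ^ (?l i mod m)) * (\<Prod>i<n. (var i ^ m) ^ (?l i div m)) = Poly_Mapping.single \<mu> (1::'k)"
    by (simp add: single_eq_prod_vars[OF \<mu>(1)] prod.distrib[symmetric] power_mult[symmetric] power_add[symmetric])
  moreover have "(\<Prod>i<n. (var 0 ^ m) ^ (?l i div m)) = (var 0 ^ (e - (\<Sum>i<n. ?l i mod m)) :: 'k mpoly)"
  proof -
    have "e = (\<Sum>i<n. ?l i mod m + m * (?l i div m))"
      using \<mu> monomial_degree_superset[OF _ \<mu>(1)] by simp
    then have "e - (\<Sum>i<n. ?l i mod m) = (\<Sum>i<n. m * (?l i div m))" by (simp only: sum.distrib)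
    then show ?thesis by (simp only: power_mult[symmetric] power_sum[symmetric])
  qed
  ultimately show ?thesis by (simp add: standard_monomial_def right_diff_distrib)
qed

text \<open>
  Modulo the relations \<open>x\<^sub>i\<^sup>m = x\<^sub>0\<^sup>m\<close> the monomials of degree \<open>e\<close> with the same exponents modulo \<open>m\<close>
  coincide, and the coefficient sums over these classes are Fourier coefficients of the
  restriction to the grid.
\<close>

lemma vanishing_on_grid_in_ideal:
  fixes J :: "'k::{alg_closed_field, field_char_0} mpoly set"
  assumes J: "ideal_of_poly_ring n J" and n: "0 < n" and m: "0 < m"
    and rel: "\<And>i. i < n \<Longrightarrow> var i ^ m - var 0 ^ m \<in> J"
    and g: "g \<in> graded_piece n e"
    and zero: "\<And>p. p \<in> unity_grid m n \<Longrightarrow> eval_mpoly p g = 0"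
  shows "g \<in> J"
proof -
  let ?K = "Poly_Mapping.keys g"
  define \<rho> where "\<rho> = (\<lambda>\<mu>. \<lambda>i\<in>{..<n}. Poly_Mapping.lookup \<mu> i mod m)"
  have std: "standard_monomial n e (\<rho> \<mu>) = standard_monomial n e (\<lambda>i. Poly_Mapping.lookup \<mu> i mod m)" for \<mu>
    by (simp add: standard_monomial_def \<rho>_def)
  have keys: "Poly_Mapping.keys \<mu> \<subseteq> {..<n}" "monomial_degree \<mu> = e" if "\<mu> \<in> ?K" for \<mu>
    using g that by (auto simp: graded_piece_def poly_ring_def)
  have class_sum: "(\<Sum>\<mu> | \<mu> \<in> ?K \<and> \<rho> \<mu> = r. Poly_Mapping.lookup g \<mu>) = 0" if r: "r \<in> \<rho> ` ?K" for r
  proof -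
    have rm: "r i < m" if "i < n" for i using r m that by (auto simp: \<rho>_def)
    have "\<rho> \<mu> = r \<longleftrightarrow> (\<forall>i<n. Poly_Mapping.lookup \<mu> i mod m = r i)" for \<mu>
      using r by (auto simp: \<rho>_def fun_eq_iff)
    then have "of_nat m ^ n * (\<Sum>\<mu> | \<mu> \<in> ?K \<and> \<rho> \<mu> = r. Poly_Mapping.lookup g \<mu>) = 0"
      using fourier_sum_eval_mpoly[OF m graded_piece_poly_ring[OF g], of r] rm zero by simp
    then show ?thesis using m by simp
  qed
  have "(\<Sum>\<mu>\<in>?K. scale_mpoly (Poly_Mapping.lookup g \<mu>) (standard_monomial n e (\<rho> \<mu>))) =
      (\<Sum>r\<in>\<rho> ` ?K. \<Sum>\<mu> | \<mu> \<in> ?K \<and> \<rho> \<mu> = r. scale_mpoly (Poly_Mapping.lookup g \<mu>) (standard_monomial n e (\<rho> \<mu>)))"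
    by (rule sum.image_gen) simp
  also have "\<dots> = (\<Sum>r\<in>\<rho> ` ?K. scale_mpoly (\<Sum>\<mu> | \<mu> \<in> ?K \<and> \<rho> \<mu> = r. Poly_Mapping.lookup g \<mu>) (standard_monomial n e r))"
    by (intro sum.cong refl) (simp add: mpoly.scale_sum_left)
  also have "\<dots> = 0" by (simp add: class_sum)
  finally have std_sum: "(\<Sum>\<mu>\<in>?K. scale_mpoly (Poly_Mapping.lookup g \<mu>) (standard_monomial n e (\<rho> \<mu>))) = 0" .
  have "(\<Sum>\<mu>\<in>?K. scale_mpoly (Poly_Mapping.lookup g \<mu>) (Poly_Mapping.single \<mu> 1 - standard_monomial n e (\<rho> \<mu>))) \<in> J"
    unfolding std using keys
    by (intro ideal_sum[OF J] ideal_scale[OF J] monomial_congruent_standard[OF J n rel]) auto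
  also have "(\<Sum>\<mu>\<in>?K. scale_mpoly (Poly_Mapping.lookup g \<mu>) (Poly_Mapping.single \<mu> 1 - standard_monomial n e (\<rho> \<mu>))) =
      (\<Sum>\<mu>\<in>?K. scale_mpoly (Poly_Mapping.lookup g \<mu>) (Poly_Mapping.single \<mu> 1))"
    by (simp add: mpoly.scale_right_diff_distrib sum_subtractf std_sum)
  also have "\<dots> = g"
    by (subst (3) poly_mapping_sum_single) (simp add: scale_mpoly_def mult_single)
  finally show ?thesis .
qed

text \<open>
  Scaling the grid by an \<open>m\<close>-th root of unity multiplies a function of weight \<open>e\<close> and a character of
  another weight by different factors, hence they are orthogonal.
\<close>

lemma fourier_coeff_eq_0_if_weight:
  fixes h :: "(nat \<Rightarrow> 'k::{alg_closed_field, field_char_0}) \<Rightarrow> 'k"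
  assumes m: "0 < m"
    and weight: "\<And>p t. p \<in> unity_grid m n \<Longrightarrow> t ^ m = 1 \<Longrightarrow> h (\<lambda>i\<in>{..<n}. t * p i) = t ^ e * h p"
    and ndvd: "\<not> m dvd e + (\<Sum>i<n. m - \<alpha> i)"
  shows "fourier_coeff m n h \<alpha> = 0"
proof -
  obtain t :: 'k where t: "t ^ m = 1" "\<And>j. 0 < j \<Longrightarrow> j < m \<Longrightarrow> t ^ j \<noteq> 1"
    using primitive_root_exists[OF m] by blast
  have t0: "t \<noteq> 0" using t(1) m by (auto simp: power_0_left)
  let ?k = "e + (\<Sum>i<n. m - \<alpha> i)"
  let ?S = "\<Sum>q\<in>unity_grid m n. h q * (\<Prod>i<n. q i ^ (m - \<alpha> i))"
  have "t ^ ?k = (t ^ m) ^ (?k div m) * t ^ (?k mod m)"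
    by (simp only: power_mult[symmetric] power_add[symmetric] mult_div_mod_eq)
  moreover have "0 < ?k mod m" "?k mod m < m" using ndvd m by (auto simp: mod_greater_zero_iff_not_dvd)
  ultimately have tk: "t ^ ?k \<noteq> 1" using t by simp
  have "?S = (\<Sum>q\<in>unity_grid m n. h (\<lambda>i\<in>{..<n}. t * q i) * (\<Prod>i<n. (t * q i) ^ (m - \<alpha> i)))"
  proof (rule sum.reindex_bij_witness[of _ "\<lambda>q. \<lambda>i\<in>{..<n}. t * q i" "\<lambda>q. \<lambda>i\<in>{..<n}. q i / t"])
    fix q :: "nat \<Rightarrow> 'k" assume q: "q \<in> unity_grid m n"
    then have ext: "(\<lambda>i\<in>{..<n}. q i) = q" by (simp add: unity_grid_def PiE_restrict)
    show "(\<lambda>i\<in>{..<n}. t * (\<lambda>i\<in>{..<n}. q i / t) i) = q"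
      using ext t0 by (simp cong: restrict_cong)
    show "(\<lambda>i\<in>{..<n}. (\<lambda>i\<in>{..<n}. t * q i) i / t) = q"
      using ext t0 by (simp cong: restrict_cong)
    show "(\<lambda>i\<in>{..<n}. q i / t) \<in> unity_grid m n" "(\<lambda>i\<in>{..<n}. t * q i) \<in> unity_grid m n"
      using unity_grid_power[OF q] t(1)
      by (simp_all add: unity_grid_def restrict_PiE_iff power_divide power_mult_distrib)
    have "(\<lambda>i\<in>{..<n}. t * (\<lambda>i\<in>{..<n}. q i / t) i) = q"
      using ext t0 by (simp cong: restrict_cong)
    moreover have "(\<Prod>i<n. (t * (\<lambda>i\<in>{..<n}. q i / t) i) ^ (m - \<alpha> i)) = (\<Prod>i<n. q i ^ (m - \<alpha> i))"
      using t0 by simp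
    ultimately show "h (\<lambda>i\<in>{..<n}. t * (\<lambda>i\<in>{..<n}. q i / t) i) * (\<Prod>i<n. (t * (\<lambda>i\<in>{..<n}. q i / t) i) ^ (m - \<alpha> i)) =
        h q * (\<Prod>i<n. q i ^ (m - \<alpha> i))" by simp
  qed
  also have "\<dots> = (\<Sum>q\<in>unity_grid m n. t ^ ?k * (h q * (\<Prod>i<n. q i ^ (m - \<alpha> i))))"
    by (intro sum.cong refl)
       (simp add: weight t(1) power_mult_distrib prod.distrib power_sum power_add mult_ac)
  also have "\<dots> = t ^ ?k * ?S" by (simp only: sum_distrib_left)
  finally have "(t ^ ?k - 1) * ?S = 0" by (simp add: left_diff_distrib)
  then show ?thesis using tk by (simp add: fourier_coeff_def)
qed

text \<open>
  A homogeneous polynomial of degree \<open>e\<close> restricts to a function of weight \<open>e\<close> for the scaling by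
  roots of unity. Conversely, such a function comes from a polynomial of degree \<open>e\<close> as soon as its
  Fourier expansion contains no character of larger degree, because the characters of smaller
  degree can be filled up with powers of \<open>x\<^sub>0\<^sup>m\<close>, which is \<open>1\<close> on the grid.
\<close>

lemma interpolation_on_grid:
  fixes h :: "(nat \<Rightarrow> 'k::{alg_closed_field, field_char_0}) \<Rightarrow> 'k"
  assumes m: "0 < m" and n: "0 < n"
    and weight: "\<And>p t. p \<in> unity_grid m n \<Longrightarrow> t ^ m = 1 \<Longrightarrow> h (\<lambda>i\<in>{..<n}. t * p i) = t ^ e * h p"
    and large: "\<And>\<alpha>. \<alpha> \<in> {..<n} \<rightarrow>\<^sub>E {..<m} \<Longrightarrow> e < (\<Sum>i<n. \<alpha> i) \<Longrightarrow>
                  m dvd e + (\<Sum>i<n. m - \<alpha> i) \<Longrightarrow> fourier_coeff m n h \<alpha> = 0"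
  shows "\<exists>H\<in>graded_piece n e. \<forall>p\<in>unity_grid m n. eval_mpoly p H = h p"
proof -
  define A where "A = {\<alpha> \<in> {..<n} \<rightarrow>\<^sub>E {..<m}. (\<Sum>i<n. \<alpha> i) \<le> e \<and> m dvd e + (\<Sum>i<n. m - \<alpha> i)}"
  define H where "H = (\<Sum>\<alpha>\<in>A. scale_mpoly (fourier_coeff m n h \<alpha>) (standard_monomial n e \<alpha>))"
  have "(standard_monomial n e \<alpha> :: 'k mpoly) \<in> graded_piece n e" if "\<alpha> \<in> A" for \<alpha>
  proof -
    have prod: "(\<Prod>i\<in>B. var i ^ \<alpha> i :: 'k mpoly) \<in> graded_piece n (\<Sum>i\<in>B. \<alpha> i)" if "finite B" "B \<subseteq> {..<n}" for B
      using that
    proof (induction B rule: finite_induct)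
      case (insert i B)
      have v: "(var i ^ \<alpha> i :: 'k mpoly) \<in> graded_piece n (\<alpha> i)"
        using graded_piece_power[OF var_graded, of i n "\<alpha> i"] insert.prems by simp
      have IH: "(\<Prod>i\<in>B. var i ^ \<alpha> i :: 'k mpoly) \<in> graded_piece n (\<Sum>i\<in>B. \<alpha> i)"
        using insert.IH insert.prems by blast
      show ?case using graded_piece_mult[OF v IH] insert.hyps by simp
    qed simp
    have pad: "(var 0 ^ (e - (\<Sum>i<n. \<alpha> i)) :: 'k mpoly) \<in> graded_piece n (e - (\<Sum>i<n. \<alpha> i))"
      using graded_piece_power[OF var_graded[OF n], of "e - (\<Sum>i<n. \<alpha> i)"] by simp
    have "(standard_monomial n e \<alpha> :: 'k mpoly) \<in> graded_piece n ((\<Sum>i<n. \<alpha> i) + (e - (\<Sum>i<n. \<alpha> i)))"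
      unfolding standard_monomial_def by (rule graded_piece_mult[OF prod[of "{..<n}"] pad]) auto
    then show ?thesis using that by (simp add: A_def)
  qed
  then have "H \<in> graded_piece n e"
    unfolding H_def by (intro graded_piece_sum graded_piece_scale)
  moreover have "eval_mpoly p H = h p" if p: "p \<in> unity_grid m n" for p
  proof -
    have eval: "eval_mpoly p (\<Prod>i\<in>B. q i) = (\<Prod>i\<in>B. eval_mpoly p (q i))" for B :: "nat set" and q
      by (induction B rule: infinite_finite_induct) auto
    have "eval_mpoly p (standard_monomial n e \<alpha>) = (\<Prod>i<n. p i ^ \<alpha> i)" if \<alpha>: "\<alpha> \<in> A" for \<alpha>
    proof -
      have le: "(\<Sum>i<n. \<alpha> i) \<le> e" and dvd: "m dvd e + (\<Sum>i<n. m - \<alpha> i)"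
        and small: "\<And>i. i < n \<Longrightarrow> \<alpha> i < m"
        using \<alpha> by (auto simp: A_def)
      have "(\<Sum>i<n. m - \<alpha> i) + (\<Sum>i<n. \<alpha> i) = (\<Sum>i<n. m)"
        unfolding sum.distrib[symmetric] by (rule sum.cong[OF refl]) (simp add: small less_imp_le)
      then have "(\<Sum>i<n. m - \<alpha> i) + (\<Sum>i<n. \<alpha> i) = n * m" by simp
      then have "e + (\<Sum>i<n. m - \<alpha> i) = (e - (\<Sum>i<n. \<alpha> i)) + n * m" using le by linarith
      then have "m dvd e - (\<Sum>i<n. \<alpha> i)" using dvd by (metis dvd_add_left_iff dvd_triv_right)
      then obtain k where "e - (\<Sum>i<n. \<alpha> i) = m * k" by (elim dvdE)
      then have "p 0 ^ (e - (\<Sum>i<n. \<alpha> i)) = 1"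
        using unity_grid_power[OF p n] by (simp add: power_mult)
      then show ?thesis by (simp add: standard_monomial_def eval)
    qed
    then have "eval_mpoly p H = (\<Sum>\<alpha>\<in>A. fourier_coeff m n h \<alpha> * (\<Prod>i<n. p i ^ \<alpha> i))"
      by (simp add: H_def)
    also have "\<dots> = (\<Sum>\<alpha>\<in>{..<n} \<rightarrow>\<^sub>E {..<m}. fourier_coeff m n h \<alpha> * (\<Prod>i<n. p i ^ \<alpha> i))"
    proof (rule sum.mono_neutral_left)
      show "finite ({..<n} \<rightarrow>\<^sub>E {..<m})" by (intro finite_PiE) auto
      show "A \<subseteq> {..<n} \<rightarrow>\<^sub>E {..<m}" by (auto simp: A_def)
      show "\<forall>\<alpha>\<in>({..<n} \<rightarrow>\<^sub>E {..<m}) - A. fourier_coeff m n h \<alpha> * (\<Prod>i<n. p i ^ \<alpha> i) = 0"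
      proof
        fix \<alpha> assume \<alpha>: "\<alpha> \<in> ({..<n} \<rightarrow>\<^sub>E {..<m}) - A"
        have "fourier_coeff m n h \<alpha> = 0"
        proof (cases "m dvd e + (\<Sum>i<n. m - \<alpha> i)")
          case True
          moreover have "e < (\<Sum>i<n. \<alpha> i)"
            using \<alpha> True unfolding A_def by (metis (mono_tags, lifting) DiffE mem_Collect_eq not_less)
          ultimately show ?thesis using \<alpha> by (metis DiffE large)
        next
          case False
          show ?thesis by (rule fourier_coeff_eq_0_if_weight[OF m weight False])
        qed
        then show "fourier_coeff m n h \<alpha> * (\<Prod>i<n. p i ^ \<alpha> i) = 0" by simp
      qed
    qed
    also have "\<dots> = h p" by (rule fourier_inversion[OF m p, symmetric])
    finally show ?thesis .
  qed
  ultimately show ?thesis by blast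
qed

section \<open>Dimensions\<close>

lemma dim_kernel_of_functionals:
  fixes \<psi> :: "nat \<Rightarrow> 'k::field mpoly \<Rightarrow> 'k"
  assumes V: "mpoly.subspace V" and fin: "finite S" "V \<subseteq> mpoly.span S"
    and add: "\<And>j p q. \<psi> j (p + q) = \<psi> j p + \<psi> j q"
    and scale: "\<And>j t p. \<psi> j (scale_mpoly t p) = t * \<psi> j p"
    and g: "\<And>j. j < n \<Longrightarrow> g j \<in> V"
    and dual: "\<And>i j. i < n \<Longrightarrow> j < n \<Longrightarrow> \<psi> i (g j) = (if i = j then 1 else 0)"
  shows "mpoly_dim V = mpoly_dim {v \<in> V. \<forall>j<n. \<psi> j v = 0} + n"
proof -
  let ?W = "{v \<in> V. \<forall>j<n. \<psi> j v = 0}"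
  have zero: "\<psi> j 0 = 0" for j using scale[of j 0 0] by simp
  obtain B where B: "B \<subseteq> ?W" "mpoly.independent B" "?W \<subseteq> mpoly.span B" "card B = mpoly.dim ?W"
    using mpoly.basis_exists[of ?W] by blast
  have "?W \<subseteq> V" by auto
  then have "B \<subseteq> mpoly.span S" using B(1) fin(2) by (meson order_trans)
  from mpoly.independent_span_bound[OF fin(1) B(2) this] have finB: "finite B" by simp
  have kernel: "mpoly.subspace {v. \<psi> j v = 0}" for j
    by (rule mpoly.subspaceI) (auto simp: zero add scale)
  have step: "mpoly.independent (B \<union> g ` {..<k}) \<and> card (B \<union> g ` {..<k}) = card B + k" if "k \<le> n" for k
    using that
  proof (induction k)
    case (Suc k)
    have "B \<subseteq> {v. \<psi> k v = 0}"
    proof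
      fix v assume "v \<in> B"
      then have "v \<in> ?W" using B(1) by (rule rev_subsetD)
      then show "v \<in> {v. \<psi> k v = 0}" using Suc.prems by simp
    qed
    moreover have "g ` {..<k} \<subseteq> {v. \<psi> k v = 0}"
      using Suc.prems by (simp add: image_subset_iff dual)
    ultimately have "mpoly.span (B \<union> g ` {..<k}) \<subseteq> {v. \<psi> k v = 0}"
      by (intro mpoly.span_minimal kernel Un_least)
    then have notin: "g k \<notin> mpoly.span (B \<union> g ` {..<k})"
      using dual[of k k] Suc.prems by (metis (mono_tags, lifting) Suc_le_lessD mem_Collect_eq subsetD zero_neq_one)
    have IH: "mpoly.independent (B \<union> g ` {..<k})" "card (B \<union> g ` {..<k}) = card B + k"
      using Suc by simp_all
    have "g k \<notin> B \<union> g ` {..<k}" using notin mpoly.span_base by metis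
    then have "card (insert (g k) (B \<union> g ` {..<k})) = card B + Suc k"
      using IH(2) finB by simp
    moreover have "B \<union> g ` {..<Suc k} = insert (g k) (B \<union> g ` {..<k})" by (simp add: lessThan_Suc)
    ultimately show ?case using mpoly.independent_insertI[OF notin IH(1)] by metis
  qed (simp add: B(2))
  let ?C = "B \<union> g ` {..<n}"
  have le: "V \<subseteq> mpoly.span ?C"
  proof
    fix v assume v: "v \<in> V"
    let ?u = "\<Sum>j<n. scale_mpoly (\<psi> j v) (g j)"
    have psi_sum: "\<psi> i (\<Sum>j\<in>A. f j) = (\<Sum>j\<in>A. \<psi> i (f j))" for i A and f :: "nat \<Rightarrow> 'k mpoly"
      by (induction A rule: infinite_finite_induct) (auto simp: zero add)
    have u: "?u \<in> V" using g by (intro mpoly.subspace_sum[OF V] mpoly.subspace_scale[OF V]) auto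
    have "\<psi> i (v - ?u) = 0" if "i < n" for i
    proof -
      have "\<psi> i v = \<psi> i (v - ?u) + \<psi> i ?u" by (simp flip: add)
      moreover have "\<psi> i ?u = (\<Sum>j<n. if i = j then \<psi> j v else 0)"
        unfolding psi_sum using that by (intro sum.cong) (auto simp: scale dual)
      ultimately show ?thesis using that by simp
    qed
    then have "v - ?u \<in> ?W" using mpoly.subspace_diff[OF V v u] by blast
    then have "v - ?u \<in> mpoly.span ?C" using B(3) mpoly.span_mono[of B ?C] by blast
    moreover have "?u \<in> mpoly.span ?C"
      by (intro mpoly.span_sum mpoly.span_scale mpoly.span_base) auto
    ultimately have "(v - ?u) + ?u \<in> mpoly.span ?C" by (rule mpoly.span_add)
    then show "v \<in> mpoly.span ?C" by simp
  qed
  have ge: "?C \<subseteq> V"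
    using B(1) \<open>?W \<subseteq> V\<close> g by (intro Un_least) (meson order_trans, simp add: image_subset_iff)
  have "mpoly.span ?C = mpoly.span V"
    using mpoly.span_mono[OF ge] mpoly.span_minimal[OF le mpoly.subspace_span] by (rule subset_antisym)
  then have "mpoly.dim V = card ?C"
    using mpoly.dim_eq_card step[OF order_refl] by metis
  then show ?thesis using step[OF order_refl] B(4) by (simp only:)
qed

lemma graded_piece_subspace: "mpoly.subspace (graded_piece n e)"
  by (rule mpoly.subspaceI) (auto intro: graded_piece_add graded_piece_scale)

lemma graded_piece_finite_span:
  "\<exists>S. finite S \<and> (graded_piece n e :: 'k::field mpoly set) \<subseteq> mpoly.span S"
proof -
  let ?D = "{\<mu>. Poly_Mapping.keys \<mu> \<subseteq> {..<n} \<and> monomial_degree \<mu> = e}"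
  let ?r = "\<lambda>\<mu>. restrict (Poly_Mapping.lookup \<mu>) {..<n}"
  have "?r ` ?D \<subseteq> exponents n e"
    using monomial_degree_superset[of "{..<n}"] by (auto intro!: restrict_in_exponents)
  then have "finite (?r ` ?D)" using finite_exponents finite_subset by blast
  moreover have "inj_on ?r ?D"
  proof (rule inj_onI)
    fix \<mu> \<nu> assume mn: "\<mu> \<in> ?D" "\<nu> \<in> ?D" and eq: "?r \<mu> = ?r \<nu>"
    show "\<mu> = \<nu>"
    proof (rule poly_mapping_eqI)
      fix i
      show "Poly_Mapping.lookup \<mu> i = Poly_Mapping.lookup \<nu> i"
      proof (cases "i < n")
        case True
        then show ?thesis using fun_cong[OF eq, of i] by simp
      next
        case False
        then have "i \<notin> Poly_Mapping.keys \<mu>" "i \<notin> Poly_Mapping.keys \<nu>" using mn by auto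
        then show ?thesis by (simp add: in_keys_iff)
      qed
    qed
  qed
  ultimately have finD: "finite ?D" by (rule finite_imageD)
  let ?S = "(\<lambda>\<mu>. Poly_Mapping.single \<mu> (1::'k)) ` ?D"
  have "p \<in> mpoly.span ?S" if p: "p \<in> graded_piece n e" for p
  proof -
    have "p = (\<Sum>\<mu>\<in>Poly_Mapping.keys p. scale_mpoly (Poly_Mapping.lookup p \<mu>) (Poly_Mapping.single \<mu> 1))"
      by (subst poly_mapping_sum_single) (simp add: scale_mpoly_def mult_single)
    also have "\<dots> \<in> mpoly.span ?S"
      using p by (intro mpoly.span_sum mpoly.span_scale mpoly.span_base) (auto simp: graded_piece_def poly_ring_def)
    finally show ?thesis .
  qed
  then show ?thesis using finD by blast
qed

section \<open>Reducedness from smoothness\<close>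

lemma eval_mpoly_on_line:
  "\<exists>q. \<forall>t. eval_mpoly (\<lambda>i. u i + t * v i) g = poly q (t :: 'k::field)"
proof -
  let ?q = "\<Sum>\<mu>\<in>Poly_Mapping.keys g. smult (Poly_Mapping.lookup g \<mu>)
      (\<Prod>i\<in>Poly_Mapping.keys \<mu>. [:u i, v i:] ^ Poly_Mapping.lookup \<mu> i)"
  have "eval_mpoly (\<lambda>i. u i + t * v i) g = poly ?q t" for t
    by (simp add: eval_mpoly_def poly_sum poly_prod poly_power)
  then show ?thesis by blast
qed

text \<open>
  On a line that avoids the origin, a polynomial without zeros outside the origin is a polynomial in
  one variable without roots, hence constant. In dimension at least two, any two points outside
  the origin are joined by a chain of such lines.
\<close>

lemma constant_if_no_zeros:
  fixes g :: "'k::{alg_closed_field, field_char_0} mpoly"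
  assumes n: "2 \<le> n" and g: "g \<in> poly_ring n"
    and nz: "\<And>a. \<exists>i<n. a i \<noteq> 0 \<Longrightarrow> eval_mpoly a g \<noteq> 0"
  shows "\<exists>\<gamma>. \<gamma> \<noteq> 0 \<and> g = Poly_Mapping.single 0 \<gamma>"
proof -
  have line: "eval_mpoly u g = eval_mpoly v g"
    if avoid: "\<And>t. \<exists>i<n. u i + t * (v i - u i) \<noteq> 0" for u v
  proof -
    obtain q where q: "\<And>t. eval_mpoly (\<lambda>i. u i + t * (v i - u i)) g = poly q t"
      using eval_mpoly_on_line[of u "\<lambda>i. v i - u i" g] by blast
    have "poly q t \<noteq> 0" for t using nz[OF avoid] q by metis
    then have "degree q = 0" using alg_closed_imp_poly_has_root[of q] by blast
    then obtain a where "q = [:a:]" by (elim degree_eq_zeroE)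
    then show ?thesis using q[of 0] q[of 1] by simp
  qed
  let ?e0 = "\<lambda>i::nat. if i = 0 then 1 else 0 :: 'k" and ?e1 = "\<lambda>i::nat. if i = 1 then 1 else 0 :: 'k"
  have from_e0: "eval_mpoly ?e0 g = eval_mpoly b g" if "i < n" "i \<noteq> 0" "b i \<noteq> 0" for b i
  proof (rule line)
    fix t
    show "\<exists>j<n. ?e0 j + t * (b j - ?e0 j) \<noteq> 0"
    proof (cases "t = 0")
      case True
      then show ?thesis using n by (intro exI[of _ 0]) simp
    next
      case False
      then show ?thesis using that by (intro exI[of _ i]) simp
    qed
  qed
  have const: "eval_mpoly b g = eval_mpoly ?e0 g" if b: "\<exists>i<n. b i \<noteq> 0" for b
  proof (cases "\<exists>i<n. i \<noteq> 0 \<and> b i \<noteq> 0")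
    case True
    then show ?thesis using from_e0 by metis
  next
    case False
    then have b0: "b 0 \<noteq> 0" using b by metis
    have "eval_mpoly ?e1 g = eval_mpoly b g"
    proof (rule line)
      fix t
      show "\<exists>j<n. ?e1 j + t * (b j - ?e1 j) \<noteq> 0"
      proof (cases "t = 0")
        case True
        then show ?thesis using n by (intro exI[of _ 1]) simp
      next
        case False
        then show ?thesis using b0 n by (intro exI[of _ 0]) simp
      qed
    qed
    then show ?thesis using from_e0[of 1 ?e1] n by simp
  qed
  let ?\<gamma> = "eval_mpoly ?e0 g"
  have "g - Poly_Mapping.single 0 ?\<gamma> = 0"
  proof (rule zero_if_vanishing[of n])
    show "g - Poly_Mapping.single 0 ?\<gamma> \<in> poly_ring n"
      using g by (intro poly_ring_diff poly_ring_single) auto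
    fix a :: "nat \<Rightarrow> 'k" assume "\<exists>i<n. a i \<noteq> 0"
    then show "eval_mpoly a (g - Poly_Mapping.single 0 ?\<gamma>) = 0"
      using const[of a] by (simp add: eval_mpoly_single monomial_value_def)
  qed (use n in simp)
  moreover have "?\<gamma> \<noteq> 0" using n by (intro nz exI[of _ 0]) simp
  ultimately show ?thesis
    by (intro exI[of _ ?\<gamma>] conjI) (simp_all only: right_minus_eq not_False_eq_True)
qed

text \<open>
  All partial derivatives of \<open>g\<^sup>2h\<close> vanish on the zero set of \<open>g\<close>, which therefore contains at most
  the origin.
\<close>

lemma reduced_if_no_singular_points:
  fixes f :: "'k::{alg_closed_field, field_char_0} mpoly"
  assumes n: "2 \<le> n" and f: "f \<noteq> 0"
    and smooth: "\<And>a. \<exists>i<n. a i \<noteq> 0 \<Longrightarrow> \<exists>i<n. eval_mpoly a (partial_deriv i f) \<noteq> 0"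
  shows "reduced_hypersurface n f"
  unfolding reduced_hypersurface_def
proof (intro conjI ballI impI f)
  fix g h assume g: "g \<in> poly_ring n" and "h \<in> poly_ring n" and fgh: "f = g ^ 2 * h"
  have "eval_mpoly a g \<noteq> 0" if "\<exists>i<n. a i \<noteq> 0" for a
    using smooth[OF that] by (auto simp: fgh power2_eq_square partial_deriv_mult)
  then obtain \<gamma> where \<gamma>: "\<gamma> \<noteq> 0" "g = Poly_Mapping.single 0 \<gamma>"
    using constant_if_no_zeros[OF n g] by blast
  then show "\<exists>u\<in>poly_ring n. g * u = 1"
    by (intro bexI[of _ "Poly_Mapping.single 0 (1 / \<gamma>)"]) (auto simp: mult_single intro: poly_ring_single)
qed

section \<open>The pencil of Fermat type\<close>

definition coordinate_sum :: "nat \<Rightarrow> (nat \<Rightarrow> 'k::field) \<Rightarrow> 'k" where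
  "coordinate_sum n p = (\<Sum>i<n. p i)"

definition sum_of_vars :: "nat \<Rightarrow> 'k::field mpoly" where
  "sum_of_vars n = (\<Sum>i<n. var i)"

definition pencil_form :: "nat \<Rightarrow> nat \<Rightarrow> 'k::field \<Rightarrow> 'k mpoly" where
  "pencil_form n d c = (\<Sum>i<n. var i ^ d) - scale_mpoly c (sum_of_vars n ^ d)"

text \<open>
  For a smooth member of the pencil and a form \<open>g\<close> of degree one less than the socle degree, this is,
  up to a scalar, the value at \<open>x\<^sub>jg\<close> of the functional on forms of the socle degree that has the
  gradient ideal as its kernel, written as a sum of local residues over the zeros of the forms
  \<open>x\<^sub>i\<^sup>m - x\<^sub>0\<^sup>m\<close>.
\<close>

definition residue :: "nat \<Rightarrow> nat \<Rightarrow> 'k::field \<Rightarrow> nat \<Rightarrow> 'k mpoly \<Rightarrow> 'k" where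
  "residue n m c j g = (\<Sum>p\<in>unity_grid m n.
     (\<Prod>i<n. p i) * p j * eval_mpoly p g / (1 - c * coordinate_sum n p ^ m))"

lemma eval_sum_of_vars [simp]: "eval_mpoly a (sum_of_vars n) = coordinate_sum n a"
  by (simp add: sum_of_vars_def coordinate_sum_def)

lemma sum_of_vars_graded: "sum_of_vars n \<in> graded_piece n 1"
  unfolding sum_of_vars_def by (intro graded_piece_sum var_graded) auto

lemma partial_deriv_sum_of_vars: "j < n \<Longrightarrow> partial_deriv j (sum_of_vars n) = 1"
  by (simp add: sum_of_vars_def partial_deriv_sum partial_deriv_var)

lemma pencil_form_graded: "pencil_form n d c \<in> graded_piece n d"
  unfolding pencil_form_def
  using graded_piece_power[OF var_graded, of _ n d] graded_piece_power[OF sum_of_vars_graded, of n d]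
  by (intro graded_piece_diff graded_piece_sum graded_piece_scale) auto

lemma partial_deriv_diff: "partial_deriv i (p - q) = partial_deriv i p - partial_deriv i q"
  using partial_deriv_add[of i "p - q" q] by simp

lemma of_nat_mult_mpoly: "of_nat j * (p :: 'k::field mpoly) = scale_mpoly (of_nat j) p"
  by (simp add: scale_mpoly_def)

lemma partial_deriv_pencil_form:
  fixes c :: "'k::field"
  assumes j: "j < n"
  shows "partial_deriv j (pencil_form n (Suc m) c) =
    scale_mpoly (of_nat (Suc m)) (var j ^ m - scale_mpoly c (sum_of_vars n ^ m))"
proof -
  have "(\<Sum>i<n. partial_deriv j (var i ^ Suc m :: 'k mpoly)) = (\<Sum>i<n. if i = j then of_nat (Suc m) * var i ^ m else 0)"
    unfolding partial_deriv_power_Suc by (intro sum.cong refl) (auto simp: partial_deriv_var)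
  also have "\<dots> = of_nat (Suc m) * var j ^ m" using j by simp
  finally show ?thesis
    unfolding pencil_form_def partial_deriv_diff partial_deriv_scale partial_deriv_sum
      partial_deriv_power_Suc[of j "sum_of_vars n"] partial_deriv_sum_of_vars[OF j]
    by (simp only: of_nat_mult_mpoly mpoly.scale_right_diff_distrib mpoly.scale_left_commute mult_1_right)
qed

lemma gradient_ideal_is_ideal:
  fixes f :: "'k::field mpoly"
  shows "ideal_of_poly_ring n (gradient_ideal n f)"
  unfolding ideal_of_poly_ring_def
proof (intro conjI ballI)
  show "0 \<in> gradient_ideal n f"
    unfolding gradient_ideal_def by (intro CollectI exI[of _ "\<lambda>_. 0"]) simp
next
  fix p q :: "'k mpoly" assume "p \<in> gradient_ideal n f" "q \<in> gradient_ideal n f"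
  then obtain g h where gh: "p = (\<Sum>i<n. g i * partial_deriv i f)" "\<forall>i<n. g i \<in> poly_ring n"
      "q = (\<Sum>i<n. h i * partial_deriv i f)" "\<forall>i<n. h i \<in> poly_ring n"
    unfolding gradient_ideal_def by blast
  then show "p + q \<in> gradient_ideal n f" unfolding gradient_ideal_def
    by (intro CollectI exI[of _ "\<lambda>i. g i + h i"]) (simp add: distrib_right sum.distrib poly_ring_add)
next
  fix r p :: "'k mpoly" assume r: "r \<in> poly_ring n" and "p \<in> gradient_ideal n f"
  then obtain g where g: "p = (\<Sum>i<n. g i * partial_deriv i f)" "\<forall>i<n. g i \<in> poly_ring n"
    unfolding gradient_ideal_def by blast
  then show "r * p \<in> gradient_ideal n f" unfolding gradient_ideal_def using r
    by (intro CollectI exI[of _ "\<lambda>i. r * g i"]) (simp add: sum_distrib_left mult.assoc poly_ring_mult)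
qed

lemma partial_deriv_in_gradient_ideal:
  assumes "i < n"
  shows "partial_deriv i f \<in> gradient_ideal n f"
proof -
  have "partial_deriv i f = (\<Sum>j<n. (if j = i then 1 else 0) * partial_deriv j f)"
    using assms by (simp add: if_distrib[of "\<lambda>x. x * _"] cong: if_cong)
  then show ?thesis unfolding gradient_ideal_def
    by (intro CollectI exI[of _ "\<lambda>j. if j = i then 1 else 0"]) simp
qed

lemma residue_add: "residue n m c j (p + q) = residue n m c j p + residue n m c j q"
  by (simp add: residue_def distrib_left add_divide_distrib sum.distrib)

lemma residue_scale: "residue n m c j (scale_mpoly t p) = t * residue n m c j p"
  unfolding residue_def sum_distrib_left by (intro sum.cong refl) (simp add: mult_ac)

lemma residue_0 [simp]: "residue n m c j 0 = 0"
  by (simp add: residue_def)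

lemma residue_sum: "residue n m c j (\<Sum>i\<in>A. p i) = (\<Sum>i\<in>A. residue n m c j (p i))"
  by (induction A rule: infinite_finite_induct) (auto simp: residue_add)

lemma prod_coordinates_times_one:
  fixes p :: "nat \<Rightarrow> 'k::comm_monoid_mult"
  assumes "j < n"
  shows "(\<Prod>i<n. p i) * p j = (\<Prod>i<n. p i ^ (if i = j then 2 else 1))"
proof -
  have "(\<Prod>i<n. p i ^ (if i = j then 2 else 1)) = (\<Prod>i<n. p i * (if i = j then p i else 1))"
    by (intro prod.cong) (auto simp: power2_eq_square)
  then show ?thesis using assms by (simp add: prod.distrib)
qed

text \<open>
  Elements of the gradient ideal are defined with arbitrary, not necessarily homogeneous,
  coefficients. Passing to homogeneous parts reduces the computation of their residues to monomial
  multiples of the partial derivatives.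
\<close>

definition hom_part :: "nat \<Rightarrow> 'k::field mpoly \<Rightarrow> 'k mpoly" where
  "hom_part e p = (\<Sum>\<mu> | \<mu> \<in> Poly_Mapping.keys p \<and> monomial_degree \<mu> = e.
     Poly_Mapping.single \<mu> (Poly_Mapping.lookup p \<mu>))"

lemma lookup_hom_part:
  "Poly_Mapping.lookup (hom_part e p) \<mu> = (if monomial_degree \<mu> = e then Poly_Mapping.lookup p \<mu> else 0)"
proof -
  have "Poly_Mapping.lookup (hom_part e p) \<mu> =
      (\<Sum>\<nu> | \<nu> \<in> Poly_Mapping.keys p \<and> monomial_degree \<nu> = e. if \<nu> = \<mu> then Poly_Mapping.lookup p \<nu> else 0)"
    unfolding hom_part_def lookup_sum by (intro sum.cong) (auto simp: lookup_single when_def)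
  then show ?thesis by (auto simp: in_keys_iff)
qed

lemma hom_part_add: "hom_part e (p + q) = hom_part e p + hom_part e q"
  by (rule poly_mapping_eqI) (simp add: lookup_hom_part lookup_add)

lemma hom_part_sum: "hom_part e (\<Sum>i\<in>A. p i) = (\<Sum>i\<in>A. hom_part e (p i))"
proof (induction A rule: infinite_finite_induct)
  case (insert i A)
  then show ?case by (simp add: hom_part_add)
qed (simp_all add: hom_part_def)

lemma hom_part_graded:
  assumes "p \<in> graded_piece n e'"
  shows "hom_part e p = (if e' = e then p else 0)"
  using assms
  by (intro poly_mapping_eqI) (auto simp: lookup_hom_part graded_piece_def in_keys_iff)

text \<open>
  The regularity assumption says that no point of the grid is singular on the member with
  parameter \<open>c\<close>. Here \<open>e\<close> is one less than the socle degree \<open>n(m - 1)\<close>.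
\<close>

locale regular_pencil =
  fixes n m e :: nat and c :: "'k::{alg_closed_field, field_char_0}"
  assumes n: "3 \<le> n" and m: "2 \<le> m" and e: "n * (m - 1) = e + 1"
    and regular: "\<And>p. p \<in> unity_grid m n \<Longrightarrow> c * coordinate_sum n p ^ m \<noteq> 1"
begin

abbreviation "f \<equiv> pencil_form n (Suc m) c"

lemma degrees: "e + 1 + n = n * m" "m \<le> e"
proof -
  obtain m' where m': "m = Suc m'" "1 \<le> m'" using m by (cases m) auto
  have "3 * m' \<le> n * m'" using n by simp
  moreover have "n * m' = e + 1" using m' e by simp
  ultimately show "m \<le> e" using m' by linarith
  show "e + 1 + n = n * m" using m' e by simp
qed

text \<open>
  A singular point satisfies \<open>a\<^sub>i\<^sup>m = c s(a)\<^sup>m\<close> for all \<open>i\<close>. The coordinates are therefore nonzero with equal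
  \<open>m\<close>-th powers, and after division by one of them the point lies on the grid, where it contradicts
  regularity.
\<close>

lemma no_singular_points:
  assumes a: "\<exists>i<n. a i \<noteq> 0"
  shows "\<exists>i<n. eval_mpoly a (partial_deriv i f) \<noteq> 0"
proof (rule ccontr)
  assume contra: "\<not> ?thesis"
  let ?s = "coordinate_sum n a"
  have eq: "a i ^ m = c * ?s ^ m" if i: "i < n" for i
  proof -
    have "eval_mpoly a (partial_deriv i f) = 0" using contra i by blast
    moreover have "(of_nat (Suc m) :: 'k) \<noteq> 0" by (rule of_nat_neq_0)
    ultimately show ?thesis
      unfolding partial_deriv_pencil_form[OF i] eval_mpoly_scale mult_eq_0_iff by simp
  qed
  obtain i where i: "i < n" "a i \<noteq> 0" using a by blast
  let ?p = "\<lambda>j\<in>{..<n}. a j / a i"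
  have "(a j / a i) ^ m = 1" if "j < n" for j
    unfolding power_divide eq[OF that] eq[OF i(1), symmetric] using i(2) by simp
  then have "?p \<in> unity_grid m n" by (simp add: unity_grid_def restrict_PiE_iff)
  moreover have "coordinate_sum n ?p = ?s / a i"
    by (simp add: coordinate_sum_def sum_divide_distrib)
  then have "c * coordinate_sum n ?p ^ m = c * ?s ^ m / a i ^ m" by (simp add: power_divide)
  then have "c * coordinate_sum n ?p ^ m = 1"
    unfolding eq[OF i(1), symmetric] using i(2) by simp
  ultimately show False using regular by blast
qed

lemma relation_in_ideal:
  assumes "i < n"
  shows "var i ^ m - scale_mpoly c (sum_of_vars n ^ m) \<in> gradient_ideal n f"
proof -
  have "(of_nat (Suc m) :: 'k) \<noteq> 0" by (rule of_nat_neq_0)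
  then have "var i ^ m - scale_mpoly c (sum_of_vars n ^ m) =
      scale_mpoly (1 / of_nat (Suc m)) (partial_deriv i f)"
    unfolding partial_deriv_pencil_form[OF assms] mpoly.scale_scale by simp
  then show ?thesis
    using ideal_scale[OF gradient_ideal_is_ideal partial_deriv_in_gradient_ideal[OF assms]] by simp
qed

lemma binomial_in_ideal:
  assumes "i < n"
  shows "var i ^ m - var 0 ^ m \<in> gradient_ideal n f"
proof -
  have "0 < n" using n by simp
  from ideal_diff[OF gradient_ideal_is_ideal relation_in_ideal[OF assms] relation_in_ideal[OF this]]
  show ?thesis by simp
qed

lemma eval_on_scaled_grid:
  assumes "g \<in> graded_piece n e'"
  shows "eval_mpoly (\<lambda>i\<in>{..<n}. t * p i) g = t ^ e' * eval_mpoly p g"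
proof -
  have "eval_mpoly (\<lambda>i\<in>{..<n}. t * p i) g = eval_mpoly (\<lambda>i. t * p i) g"
    using graded_piece_poly_ring[OF assms] by (rule eval_mpoly_cong) simp
  then show ?thesis using eval_mpoly_homogeneous[OF assms] by simp
qed

lemma coordinate_sum_scaled: "coordinate_sum n (\<lambda>i\<in>{..<n}. t * p i) = t * coordinate_sum n p"
  by (simp add: coordinate_sum_def sum_distrib_left)

lemma residue_monomial_multiple:
  assumes i: "i < n" and j: "j < n" and \<mu>: "Poly_Mapping.keys \<mu> \<subseteq> {..<n}"
    and deg: "monomial_degree \<mu> + m = e"
  shows "residue n m c j (Poly_Mapping.single \<mu> a * partial_deriv i f) = 0"
proof -
  let ?\<beta> = "\<lambda>l. (if l = j then 2 else 1) + Poly_Mapping.lookup \<mu> l"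
  have "residue n m c j (Poly_Mapping.single \<mu> a * partial_deriv i f) =
      (\<Sum>p\<in>unity_grid m n. a * of_nat (Suc m) * (\<Prod>l<n. p l ^ ?\<beta> l))"
    unfolding residue_def
  proof (rule sum.cong[OF refl])
    fix p :: "nat \<Rightarrow> 'k" assume p: "p \<in> unity_grid m n"
    have "eval_mpoly p (partial_deriv i f) = of_nat (Suc m) * (1 - c * coordinate_sum n p ^ m)"
      using unity_grid_power[OF p i]
      by (simp only: partial_deriv_pencil_form[OF i] eval_mpoly_scale eval_mpoly_diff eval_mpoly_power
          eval_var eval_sum_of_vars)
    moreover have "1 - c * coordinate_sum n p ^ m \<noteq> 0" using regular[OF p] by simp
    moreover have "(\<Prod>l<n. p l) * p j * monomial_value p \<mu> = (\<Prod>l<n. p l ^ ?\<beta> l)"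
      by (simp only: prod_coordinates_times_one[OF j] monomial_value_poly_ring[OF \<mu>] power_add prod.distrib)
    ultimately show "(\<Prod>i<n. p i) * p j * eval_mpoly p (Poly_Mapping.single \<mu> a * partial_deriv i f) /
        (1 - c * coordinate_sum n p ^ m) = a * of_nat (Suc m) * (\<Prod>l<n. p l ^ ?\<beta> l)"
      by (simp add: eval_mpoly_single mult_ac del: of_nat_Suc)
  qed
  also have "\<dots> = a * of_nat (Suc m) * (\<Sum>p\<in>unity_grid m n. \<Prod>l<n. p l ^ ?\<beta> l)"
    by (rule sum_distrib_left[symmetric])
  also have "(\<Sum>p\<in>unity_grid m n. \<Prod>l<n. p l ^ ?\<beta> l) = (0::'k)"
  proof -
    \<comment> \<open>All these exponents are positive. If \<open>m\<close> divided each of them, their sum would be at least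
      \<open>n * m\<close>, but it is \<open>n * m - m\<close>.\<close>
    have "\<not> (\<forall>l<n. m dvd ?\<beta> l)"
    proof
      assume "\<forall>l<n. m dvd ?\<beta> l"
      then have "(\<Sum>l<n. m) \<le> (\<Sum>l<n. ?\<beta> l)" by (intro sum_mono dvd_imp_le) auto
      moreover have "(\<Sum>l<n. if l = j then 2 else 1 :: nat) = n + 1"
      proof -
        have "(\<Sum>l<n. if l = j then 2 else 1 :: nat) = (\<Sum>l<n. 1 + (if l = j then 1 else 0))"
          by (intro sum.cong) auto
        also have "\<dots> = (\<Sum>l<n. 1) + (\<Sum>l<n. if l = j then 1 else 0)" by (rule sum.distrib)
        finally show ?thesis using j by simp
      qed
      then have "(\<Sum>l<n. ?\<beta> l) = n + 1 + monomial_degree \<mu>"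
        using monomial_degree_superset[OF _ \<mu>] by (simp add: sum.distrib)
      moreover have "(\<Sum>l<n. m) = n * m" by simp
      ultimately show False using deg degrees m by linarith
    qed
    then show ?thesis using m by (subst sum_unity_grid_monomial) auto
  qed
  finally show ?thesis by simp
qed

lemma residue_eq_0_on_ideal:
  assumes g: "g \<in> gradient_ideal n f" "g \<in> graded_piece n e" and j: "j < n"
  shows "residue n m c j g = 0"
proof -
  obtain q where q: "g = (\<Sum>i<n. q i * partial_deriv i f)" "\<forall>i<n. q i \<in> poly_ring n"
    using g(1) unfolding gradient_ideal_def by blast
  have part: "partial_deriv i f \<in> graded_piece n m" if "i < n" for i
    unfolding partial_deriv_pencil_form[OF that]
    using graded_piece_power[OF var_graded[OF that], of m] graded_piece_power[OF sum_of_vars_graded[of n], of m]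
    by (intro graded_piece_scale graded_piece_diff) auto
  have summand: "residue n m c j (hom_part e (q i * partial_deriv i f)) = 0" if i: "i < n" for i
  proof -
    have "residue n m c j (hom_part e (Poly_Mapping.single \<mu> a * partial_deriv i f)) = 0"
      if \<mu>: "\<mu> \<in> Poly_Mapping.keys (q i)" for \<mu> a
    proof -
      have keys: "Poly_Mapping.keys \<mu> \<subseteq> {..<n}" using q(2) i \<mu> by (auto simp: poly_ring_def)
      have "Poly_Mapping.single \<mu> a * partial_deriv i f \<in> graded_piece n (monomial_degree \<mu> + m)"
        by (intro graded_piece_mult graded_piece_single part keys i refl)
      then show ?thesis
        using residue_monomial_multiple[OF i j keys] by (simp add: hom_part_graded)
    qed
    then have "residue n m c j (hom_part e ((\<Sum>\<mu>\<in>Poly_Mapping.keys (q i).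
        Poly_Mapping.single \<mu> (Poly_Mapping.lookup (q i) \<mu>)) * partial_deriv i f)) = 0"
      by (simp add: sum_distrib_right hom_part_sum residue_sum)
    then show ?thesis by (simp only: poly_mapping_sum_single[symmetric])
  qed
  have "g = hom_part e g" using hom_part_graded[OF g(2)] by simp
  also have "\<dots> = (\<Sum>i<n. hom_part e (q i * partial_deriv i f))"
    unfolding q(1) by (rule hom_part_sum)
  finally have "residue n m c j g = residue n m c j (\<Sum>i<n. hom_part e (q i * partial_deriv i f))"
    by (rule arg_cong)
  also have "\<dots> = (\<Sum>i<n. residue n m c j (hom_part e (q i * partial_deriv i f)))"
    by (rule residue_sum)
  finally have "residue n m c j g = (\<Sum>i<n. residue n m c j (hom_part e (q i * partial_deriv i f)))" .
  then show ?thesis using summand by simp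
qed

lemma complementary_exponent_sums:
  assumes "\<alpha> \<in> {..<n} \<rightarrow>\<^sub>E {..<m}"
  shows "(\<Sum>i<n. m - \<alpha> i) + (\<Sum>i<n. \<alpha> i) = n * m"
    and "(\<Sum>i<n. m - 1 - \<alpha> i) + (\<Sum>i<n. \<alpha> i) = e + 1"
proof -
  have \<alpha>: "\<alpha> i < m" if "i < n" for i using PiE_mem[OF assms, of i] that by simp
  have "(\<Sum>i<n. m - \<alpha> i) + (\<Sum>i<n. \<alpha> i) = (\<Sum>i<n. m)"
    unfolding sum.distrib[symmetric] by (rule sum.cong[OF refl]) (simp add: \<alpha> less_imp_le)
  then show "(\<Sum>i<n. m - \<alpha> i) + (\<Sum>i<n. \<alpha> i) = n * m" by simp
  have "(\<Sum>i<n. m - 1 - \<alpha> i) + (\<Sum>i<n. \<alpha> i) = (\<Sum>i<n. m - 1)"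
    unfolding sum.distrib[symmetric]
  proof (rule sum.cong[OF refl])
    fix i assume "i \<in> {..<n}"
    then show "m - 1 - \<alpha> i + \<alpha> i = m - 1" using \<alpha>[of i] by simp
  qed
  then show "(\<Sum>i<n. m - 1 - \<alpha> i) + (\<Sum>i<n. \<alpha> i) = e + 1" using e by simp
qed

lemma dvd_degree_difference:
  assumes \<alpha>: "\<alpha> \<in> {..<n} \<rightarrow>\<^sub>E {..<m}" and large: "e' < (\<Sum>i<n. \<alpha> i)" and dvd: "m dvd e' + (\<Sum>i<n. m - \<alpha> i)"
  shows "m dvd (\<Sum>i<n. \<alpha> i) - e'"
proof -
  have "((\<Sum>i<n. \<alpha> i) - e') + (e' + (\<Sum>i<n. m - \<alpha> i)) = n * m"
    using complementary_exponent_sums(1)[OF \<alpha>] large by linarith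
  then show ?thesis using dvd by (metis dvd_add_left_iff dvd_triv_right)
qed

text \<open>
  Dividing \<open>g\<close> by \<open>x\<^sub>0\<^sup>m - c(x\<^sub>0 + \<dots>)\<^sup>m\<close> is possible on the grid, where this form has no zeros. The
  quotient has the right weight for a form of degree \<open>e - m\<close>, and the only characters of that weight
  with too large a degree are the \<open>n\<close> characters of degree \<open>e\<close>; their coefficients are the residues.
\<close>

lemma in_ideal_if_residues_eq_0:
  assumes g: "g \<in> graded_piece n e" and zero: "\<And>j. j < n \<Longrightarrow> residue n m c j g = 0"
  shows "g \<in> gradient_ideal n f"
proof -
  have m0: "0 < m" and n0: "0 < n" using m n by simp_all
  define h where "h = (\<lambda>p. eval_mpoly p g / (1 - c * coordinate_sum n p ^ m))"
  have "\<exists>H\<in>graded_piece n (e - m). \<forall>p\<in>unity_grid m n. eval_mpoly p H = h p"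
  proof (rule interpolation_on_grid[OF m0 n0])
    fix p :: "nat \<Rightarrow> 'k" and t :: 'k assume "p \<in> unity_grid m n" and t: "t ^ m = 1"
    have "t ^ e = t ^ (e - m) * t ^ m"
      using le_add_diff_inverse2[OF degrees(2)] by (metis power_add)
    then show "h (\<lambda>i\<in>{..<n}. t * p i) = t ^ (e - m) * h p"
      using t by (simp add: h_def eval_on_scaled_grid[OF g] coordinate_sum_scaled power_mult_distrib)
  next
    fix \<alpha> assume \<alpha>: "\<alpha> \<in> {..<n} \<rightarrow>\<^sub>E {..<m}" and large: "e - m < (\<Sum>i<n. \<alpha> i)"
      and dvd: "m dvd e - m + (\<Sum>i<n. m - \<alpha> i)"
    have "m dvd (\<Sum>i<n. \<alpha> i) - (e - m)" by (rule dvd_degree_difference[OF \<alpha> large dvd])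
    then obtain k where k: "(\<Sum>i<n. \<alpha> i) - (e - m) = m * k" by (elim dvdE)
    \<comment> \<open>The degree of \<open>\<alpha>\<close> exceeds \<open>e - m\<close> by a positive multiple of \<open>m\<close> that is at most \<open>m + 1\<close>, so it
      is \<open>e\<close>, one less than the largest possible degree \<open>n(m - 1)\<close>.\<close>
    have "(\<Sum>i<n. \<alpha> i) - (e - m) \<le> m + 1"
      using complementary_exponent_sums(2)[OF \<alpha>] degrees(2) by linarith
    then have "m * k < m * 2" using k m by linarith
    moreover have "0 < m * k" using k large by linarith
    ultimately have "k = 1" by auto
    then have "(\<Sum>i<n. \<alpha> i) - (e - m) = m" using k by simp
    then have "(\<Sum>i<n. \<alpha> i) = e" using large degrees(2) by linarith
    then have "(\<Sum>i<n. m - 1 - \<alpha> i) = 1" using complementary_exponent_sums(2)[OF \<alpha>] by linarith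
    then have "\<exists>j\<in>{..<n}. m - 1 - \<alpha> j = 1 \<and> (\<forall>i\<in>{..<n}. j \<noteq> i \<longrightarrow> m - 1 - \<alpha> i = 0)"
      by (simp only: sum_eq_1_iff[OF finite_lessThan])
    then obtain j where j: "j < n" "m - 1 - \<alpha> j = 1" "\<And>i. i < n \<Longrightarrow> i \<noteq> j \<Longrightarrow> m - 1 - \<alpha> i = 0"
      by (metis lessThan_iff)
    have exponent: "m - \<alpha> i = (if i = j then 2 else 1)" if "i < n" for i
    proof -
      have "\<alpha> i < m" using PiE_mem[OF \<alpha>, of i] that by simp
      then have "m - \<alpha> i = 1 + (m - 1 - \<alpha> i)" by simp
      then show ?thesis using j that by simp
    qed
    have "(\<Prod>i<n. q i ^ (m - \<alpha> i)) = (\<Prod>i<n. q i) * q j" for q :: "nat \<Rightarrow> 'k"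
      unfolding prod_coordinates_times_one[OF j(1)] by (rule prod.cong[OF refl]) (simp add: exponent)
    then have "(\<Sum>q\<in>unity_grid m n. h q * (\<Prod>i<n. q i ^ (m - \<alpha> i))) = residue n m c j g"
      unfolding residue_def h_def by (intro sum.cong refl) (simp add: mult_ac)
    then show "fourier_coeff m n h \<alpha> = 0" by (simp add: fourier_coeff_def zero[OF j(1)])
  qed
  then obtain H where H: "H \<in> graded_piece n (e - m)" "\<And>p. p \<in> unity_grid m n \<Longrightarrow> eval_mpoly p H = h p"
    by metis
  let ?w = "var 0 ^ m - scale_mpoly c (sum_of_vars n ^ m)"
  have "?w \<in> graded_piece n m"
    using graded_piece_power[OF var_graded[OF n0], of m] graded_piece_power[OF sum_of_vars_graded[of n], of m]
    by (intro graded_piece_scale graded_piece_diff) auto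
  then have "H * ?w \<in> graded_piece n (e - m + m)" using H(1) by (intro graded_piece_mult)
  then have Hw: "H * ?w \<in> graded_piece n e" using degrees(2) by simp
  have "g - H * ?w \<in> gradient_ideal n f"
  proof (rule vanishing_on_grid_in_ideal[OF gradient_ideal_is_ideal n0 m0])
    show "g - H * ?w \<in> graded_piece n e" by (rule graded_piece_diff[OF g Hw])
    fix p :: "nat \<Rightarrow> 'k" assume p: "p \<in> unity_grid m n"
    have "1 - c * coordinate_sum n p ^ m \<noteq> 0" using regular[OF p] by simp
    then show "eval_mpoly p (g - H * ?w) = 0"
      using unity_grid_power[OF p n0] by (simp add: H(2)[OF p] h_def)
  qed (rule binomial_in_ideal)
  moreover have "H * ?w \<in> gradient_ideal n f"
    using ideal_mult[OF gradient_ideal_is_ideal graded_piece_poly_ring[OF H(1)] relation_in_ideal[OF n0]] .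
  ultimately have "(g - H * ?w) + H * ?w \<in> gradient_ideal n f"
    by (rule ideal_add[OF gradient_ideal_is_ideal])
  then show ?thesis by simp
qed

text \<open>
  The denominator of the residue is cancelled by a factor \<open>1 - c s\<^sup>m\<close>, and the rest is the character
  dual to the \<open>j\<close>-th residue. This function on the grid is the restriction of a form of degree \<open>e\<close>: the
  degree of a character is at most \<open>e + 1\<close>, and \<open>e + 1\<close> does not have the weight of \<open>e\<close>.
\<close>

lemma dual_element_exists:
  assumes j: "j < n"
  shows "\<exists>g\<in>graded_piece n e. \<forall>i<n. residue n m c i g = (if i = j then 1 else 0)"
proof -
  have m0: "0 < m" and n0: "0 < n" using m n by simp_all
  let ?\<alpha> = "\<lambda>l. m - (if l = j then 2 else 1)"
  define h where "h = (\<lambda>p::nat \<Rightarrow> 'k. (1 - c * coordinate_sum n p ^ m) * (\<Prod>l<n. p l ^ ?\<alpha> l) / of_nat m ^ n)"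
  have "\<exists>H\<in>graded_piece n e. \<forall>p\<in>unity_grid m n. eval_mpoly p H = h p"
  proof (rule interpolation_on_grid[OF m0 n0])
    fix p :: "nat \<Rightarrow> 'k" and t :: 'k assume "p \<in> unity_grid m n" and t: "t ^ m = 1"
    have "(\<Sum>l<n. ?\<alpha> l) + (\<Sum>l<n. if l = j then 1 else 0) = (\<Sum>l<n. m - 1)"
      unfolding sum.distrib[symmetric] using m by (intro sum.cong) auto
    then have "(\<Sum>l<n. ?\<alpha> l) + 1 = e + 1" using j e by simp
    then have "(\<Sum>l<n. ?\<alpha> l) = e" by simp
    then have "(\<Prod>l<n. (t * p l) ^ ?\<alpha> l) = t ^ e * (\<Prod>l<n. p l ^ ?\<alpha> l)"
      by (simp only: power_mult_distrib prod.distrib power_sum[symmetric])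
    moreover have "(\<Prod>l<n. (\<lambda>i\<in>{..<n}. t * p i) l ^ ?\<alpha> l) = (\<Prod>l<n. (t * p l) ^ ?\<alpha> l)"
      by (rule prod.cong) auto
    ultimately show "h (\<lambda>i\<in>{..<n}. t * p i) = t ^ e * h p"
      using t by (simp only: h_def coordinate_sum_scaled power_mult_distrib) simp
  next
    fix \<alpha> assume \<alpha>: "\<alpha> \<in> {..<n} \<rightarrow>\<^sub>E {..<m}" and large: "e < (\<Sum>i<n. \<alpha> i)"
      and dvd: "m dvd e + (\<Sum>i<n. m - \<alpha> i)"
    have "(\<Sum>i<n. \<alpha> i) - e = 1" using complementary_exponent_sums(2)[OF \<alpha>] large by linarith
    then show "fourier_coeff m n h \<alpha> = 0"
      using dvd_degree_difference[OF \<alpha> large dvd] m by simp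
  qed
  then obtain H where H: "H \<in> graded_piece n e" "\<And>p. p \<in> unity_grid m n \<Longrightarrow> eval_mpoly p H = h p"
    by blast
  have "residue n m c i H = (if i = j then 1 else 0)" if i: "i < n" for i
  proof -
    let ?\<beta> = "\<lambda>l. (if l = i then 2 else 1) + ?\<alpha> l"
    have "residue n m c i H = (\<Sum>p\<in>unity_grid m n. (\<Prod>l<n. p l ^ ?\<beta> l) / of_nat m ^ n)"
      unfolding residue_def
    proof (rule sum.cong[OF refl])
      fix p :: "nat \<Rightarrow> 'k" assume p: "p \<in> unity_grid m n"
      have "1 - c * coordinate_sum n p ^ m \<noteq> 0" using regular[OF p] by simp
      then have "(\<Prod>i<n. p i) * p i * eval_mpoly p H / (1 - c * coordinate_sum n p ^ m) =
          (\<Prod>i<n. p i) * p i * (\<Prod>l<n. p l ^ ?\<alpha> l) / of_nat m ^ n"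
        by (simp add: H(2)[OF p] h_def)
      also have "\<dots> = (\<Prod>l<n. p l ^ ?\<beta> l) / of_nat m ^ n"
        by (simp only: prod_coordinates_times_one[OF i] power_add prod.distrib)
      finally show "(\<Prod>i<n. p i) * p i * eval_mpoly p H / (1 - c * coordinate_sum n p ^ m) =
          (\<Prod>l<n. p l ^ ?\<beta> l) / of_nat m ^ n" .
    qed
    also have "\<dots> = (\<Sum>p\<in>unity_grid m n. \<Prod>l<n. p l ^ ?\<beta> l) / of_nat m ^ n"
      by (rule sum_divide_distrib[symmetric])
    also have "(\<Sum>p\<in>unity_grid m n. \<Prod>l<n. p l ^ ?\<beta> l) = (if i = j then of_nat m ^ n else 0 :: 'k)"
    proof -
      have "(\<forall>l<n. m dvd ?\<beta> l) \<longleftrightarrow> i = j"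
      proof
        assume "\<forall>l<n. m dvd ?\<beta> l"
        then have "m dvd ?\<beta> i" using i by blast
        show "i = j"
        proof (rule ccontr)
          assume "i \<noteq> j"
          then have "?\<beta> i = m + 1" using m by simp
          with \<open>m dvd ?\<beta> i\<close> have "m dvd 1" by (metis dvd_add_right_iff dvd_refl)
          then show False using m by simp
        qed
      next
        assume "i = j"
        then show "\<forall>l<n. m dvd ?\<beta> l" using m by auto
      qed
      then show ?thesis using sum_unity_grid_monomial[OF m0, of ?\<beta> n] by simp
    qed
    finally show ?thesis using m by simp
  qed
  then show ?thesis using H(1) by blast
qed

lemma gradient_ideal_piece_eq:
  "gradient_ideal_piece n f e = {g \<in> graded_piece n e. \<forall>j<n. residue n m c j g = 0}"
  unfolding gradient_ideal_piece_def
  using residue_eq_0_on_ideal in_ideal_if_residues_eq_0 by blast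

lemma codimension: "proj_codim (graded_piece n e) (gradient_ideal_piece n f e) = int n"
proof -
  obtain S :: "'k mpoly set" where S: "finite S" "graded_piece n e \<subseteq> mpoly.span S"
    using graded_piece_finite_span by blast
  obtain g where g: "\<And>j. j < n \<Longrightarrow> g j \<in> graded_piece n e \<and> (\<forall>i<n. residue n m c i (g j) = (if i = j then 1 else 0))"
    using dual_element_exists by metis
  have "mpoly_dim (graded_piece n e :: 'k mpoly set) = mpoly_dim (gradient_ideal_piece n f e) + n"
    unfolding gradient_ideal_piece_eq
  proof (rule dim_kernel_of_functionals)
    show "mpoly.subspace (graded_piece n e :: 'k mpoly set)" by (rule graded_piece_subspace)
    show "finite S" "graded_piece n e \<subseteq> mpoly.span S" by fact+
    show "g j \<in> graded_piece n e" if "j < n" for j using g[OF that] by blast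
    show "residue n m c i (g j) = (if i = j then 1 else 0)" if "i < n" "j < n" for i j
      using g[OF that(2)] that(1) by blast
  qed (simp_all add: residue_add residue_scale)
  then show ?thesis by (simp add: proj_codim_def)
qed

end

section \<open>The limit of the pencil at its nodal member\<close>

locale node_configuration =
  fixes n m e :: nat and w :: "'k::{alg_closed_field, field_char_0}"
  assumes n: "3 \<le> n" and m: "2 \<le> m" and e: "n * (m - 1) = e + 1"
    and w_root: "w ^ m = 1" and w_neq_1: "w \<noteq> 1" and node_sum: "of_nat n - 1 + w \<noteq> 0"
    and isolated: "\<And>z. \<forall>i<n. z i ^ m = 1 \<Longrightarrow> (\<Sum>i<n. z i) = of_nat n - 1 + w \<Longrightarrow>
                     \<exists>l<n. z l = w \<and> (\<forall>i<n. i \<noteq> l \<longrightarrow> z i = 1)"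
begin

definition N :: 'k where "N = of_nat n - 1 + w"

definition node :: "nat \<Rightarrow> nat \<Rightarrow> 'k" where
  "node l i = (if i = l then w else 1)"

definition scaled_node :: "'k \<Rightarrow> nat \<Rightarrow> nat \<Rightarrow> 'k" where
  "scaled_node t l = (\<lambda>i\<in>{..<n}. t * node l i)"

text \<open>
  The coordinates with respect to the basis of the nodes.
\<close>

definition node_coordinate :: "nat \<Rightarrow> (nat \<Rightarrow> 'k) \<Rightarrow> 'k" where
  "node_coordinate j x = (x j - coordinate_sum n x / N) / (w - 1)"

lemma N_neq_0: "N \<noteq> 0"
  using node_sum by (simp add: N_def)

lemma sum_node: "l < n \<Longrightarrow> (\<Sum>i<n. f i * node l i) = (\<Sum>i<n. f i) + (w - 1) * f l"
proof -
  assume l: "l < n"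
  have "(\<Sum>i<n. f i * node l i) = (\<Sum>i<n. f i + (if i = l then (w - 1) * f i else 0))"
    by (intro sum.cong) (auto simp: node_def algebra_simps)
  then show ?thesis using l by (simp add: sum.distrib)
qed

lemma coordinate_sum_scaled_node:
  assumes "l < n"
  shows "coordinate_sum n (scaled_node t l) = t * N"
proof -
  have "(\<Sum>i<n. t * node l i) = (\<Sum>i<n. t) + (w - 1) * t" by (rule sum_node[OF assms])
  then show ?thesis by (simp add: coordinate_sum_def scaled_node_def N_def algebra_simps)
qed

lemma node_coordinate_scaled_node:
  assumes "j < n" "l < n"
  shows "node_coordinate j (scaled_node t l) = (if j = l then t else 0)"
proof -
  have "w - 1 \<noteq> 0" using w_neq_1 by simp
  have "node_coordinate j (scaled_node t l) = (t * node l j - t) / (w - 1)"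
    unfolding node_coordinate_def coordinate_sum_scaled_node[OF assms(2)]
    using N_neq_0 assms(1) by (simp add: scaled_node_def)
  also have "\<dots> = (if j = l then t else 0)"
  proof (cases "j = l")
    case True
    have "t * w - t = t * (w - 1)" by (simp add: algebra_simps)
    then show ?thesis using True \<open>w - 1 \<noteq> 0\<close> by (simp add: node_def)
  qed (simp add: node_def)
  finally show ?thesis .
qed

lemma sum_node_coordinates:
  "(\<Sum>j<n. node_coordinate j p * (\<Sum>i<n. a i * node j i)) = (\<Sum>i<n. a i * p i)"
proof -
  let ?S = "\<Sum>i<n. a i" and ?P = "coordinate_sum n p"
  have w1: "w - 1 \<noteq> 0" using w_neq_1 by simp
  have total: "(\<Sum>j<n. node_coordinate j p) = ?P / N"
  proof -
    have "(\<Sum>j<n. node_coordinate j p) = (?P - of_nat n * (?P / N)) / (w - 1)"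
      by (simp add: node_coordinate_def sum_divide_distrib[symmetric] sum_subtractf coordinate_sum_def)
    also have "?P - of_nat n * (?P / N) = (?P / N) * (N - of_nat n)"
      using N_neq_0 by (simp add: field_simps)
    also have "N - of_nat n = w - 1" by (simp add: N_def)
    finally show ?thesis using w1 by simp
  qed
  have "(\<Sum>j<n. node_coordinate j p * (\<Sum>i<n. a i * node j i)) =
      (\<Sum>j<n. node_coordinate j p * ?S + (p j - ?P / N) * a j)"
  proof (rule sum.cong[OF refl])
    fix j assume "j \<in> {..<n}"
    then have "(\<Sum>i<n. a i * node j i) = ?S + (w - 1) * a j" using sum_node by simp
    then show "node_coordinate j p * (\<Sum>i<n. a i * node j i) = node_coordinate j p * ?S + (p j - ?P / N) * a j"
      using w1 by (simp add: distrib_left node_coordinate_def)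
  qed
  also have "\<dots> = (\<Sum>j<n. node_coordinate j p * ?S + (a j * p j - ?P / N * a j))"
    by (simp add: left_diff_distrib right_diff_distrib mult.commute)
  also have "\<dots> = (\<Sum>j<n. node_coordinate j p) * ?S + ((\<Sum>j<n. a j * p j) - ?P / N * ?S)"
    by (simp only: sum.distrib sum_subtractf sum_distrib_left[symmetric] sum_distrib_right[symmetric])
  finally show ?thesis unfolding total by simp
qed

lemma node_system_injective:
  assumes zero: "\<And>l. l < n \<Longrightarrow> (\<Sum>i<n. a i * node l i) = 0" and l: "l < n"
  shows "a l = 0"
proof -
  let ?S = "\<Sum>i<n. a i"
  have eq: "?S + (w - 1) * a l = 0" if "l < n" for l using zero[OF that] sum_node[OF that] by simp
  have "0 = (\<Sum>l<n. ?S + (w - 1) * a l)" using eq by simp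
  also have "\<dots> = of_nat n * ?S + (w - 1) * ?S"
    by (simp add: sum.distrib sum_distrib_left[symmetric])
  also have "\<dots> = N * ?S" by (simp add: N_def algebra_simps)
  finally have "?S = 0" using N_neq_0 by simp
  then show ?thesis using eq[OF l] w_neq_1 by simp
qed

text \<open>
  The grid points at which the parameter \<open>1/N\<^sup>m\<close> fails to be regular are the singular points of
  that member of the pencil. By the choice of \<open>w\<close> these are exactly the multiples of the nodes.
\<close>

lemma nodes_bij:
  "bij_betw (\<lambda>(t, l). scaled_node t l) ({t. t ^ m = 1} \<times> {..<n})
     {p \<in> unity_grid m n. coordinate_sum n p ^ m = N ^ m}"
proof (rule bij_betwI')
  fix x y :: "'k \<times> nat" assume x: "x \<in> {t. t ^ m = 1} \<times> {..<n}" and y: "y \<in> {t. t ^ m = 1} \<times> {..<n}"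
  obtain t l t' l' where xy: "x = (t, l)" "y = (t', l')" by (cases x, cases y)
  have t: "t \<noteq> 0" using x xy m by (auto simp: power_0_left)
  have l: "l < n" "l' < n" using x y xy by auto
  have "x = y" if eq: "scaled_node t l = scaled_node t' l'"
  proof -
    have "(if l = l then t else 0) = (if l = l' then t' else 0)"
      using node_coordinate_scaled_node[OF l(1) l(1)] node_coordinate_scaled_node[OF l(1) l(2)] eq by metis
    then show ?thesis using t xy by (auto split: if_splits)
  qed
  then show "((case x of (t, l) \<Rightarrow> scaled_node t l) = (case y of (t, l) \<Rightarrow> scaled_node t l)) = (x = y)"
    by (auto simp: xy)
next
  fix x assume "x \<in> {t :: 'k. t ^ m = 1} \<times> {..<n}"
  then obtain t l where x: "x = (t, l)" "t ^ m = 1" "l < n" by auto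
  have "scaled_node t l \<in> unity_grid m n"
    using x(2) w_root by (simp add: scaled_node_def unity_grid_def restrict_PiE_iff power_mult_distrib node_def)
  then show "(case x of (t, l) \<Rightarrow> scaled_node t l) \<in> {p \<in> unity_grid m n. coordinate_sum n p ^ m = N ^ m}"
    using x by (simp add: coordinate_sum_scaled_node power_mult_distrib)
next
  fix p assume p: "p \<in> {p \<in> unity_grid m n. coordinate_sum n p ^ m = N ^ m}"
  define t where "t = coordinate_sum n p / N"
  have tm: "t ^ m = 1" using p N_neq_0 by (simp add: t_def power_divide)
  then have t0: "t \<noteq> 0" using m by (auto simp: power_0_left)
  have grid: "p \<in> unity_grid m n" using p by simp
  have "(p i / t) ^ m = 1" if "i < n" for i
    using unity_grid_power[OF grid that] tm by (simp add: power_divide)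
  moreover have "(\<Sum>i<n. p i / t) = of_nat n - 1 + w"
  proof -
    have "(\<Sum>i<n. p i / t) = coordinate_sum n p / t"
      unfolding coordinate_sum_def by (rule sum_divide_distrib[symmetric])
    also have "coordinate_sum n p = t * N" using N_neq_0 by (simp add: t_def)
    finally show ?thesis using t0 by (simp add: N_def)
  qed
  ultimately obtain l where l: "l < n" "p l / t = w" "\<forall>i<n. i \<noteq> l \<longrightarrow> p i / t = 1"
    using isolated[of "\<lambda>i. p i / t"] by blast
  have "p i = t * node l i" if "i < n" for i
    using l that t0 by (auto simp: node_def field_simps)
  moreover have "(\<lambda>i\<in>{..<n}. p i) = p" using grid by (simp add: unity_grid_def PiE_restrict)
  ultimately have "scaled_node t l = p"
    unfolding scaled_node_def by (metis (mono_tags, lifting) lessThan_iff restrict_ext)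
  then show "\<exists>x\<in>{t. t ^ m = 1} \<times> {..<n}. p = (case x of (t, l) \<Rightarrow> scaled_node t l)"
    using tm l(1) by (intro bexI[of _ "(t, l)"]) auto
qed

definition grid_values :: "'k set" where
  "grid_values = (\<lambda>p. coordinate_sum n p ^ m) ` unity_grid m n"

text \<open>
  The weight \<open>1/(1 - c s(p)\<^sup>m)\<close> multiplied by the common denominator of all weights, as a polynomial
  in the parameter.
\<close>

definition weight :: "(nat \<Rightarrow> 'k) \<Rightarrow> 'k poly" where
  "weight p = (\<Prod>x\<in>grid_values - {coordinate_sum n p ^ m}. [:1, - x:])"

lemma finite_grid_values: "finite grid_values"
  unfolding grid_values_def using m by simp

lemma weight_regular:
  assumes p: "p \<in> unity_grid m n" and "c * coordinate_sum n p ^ m \<noteq> 1"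
  shows "poly (weight p) c = (\<Prod>x\<in>grid_values. 1 - c * x) / (1 - c * coordinate_sum n p ^ m)"
proof -
  have "coordinate_sum n p ^ m \<in> grid_values" using p by (auto simp: grid_values_def)
  then have "(\<Prod>x\<in>grid_values. 1 - c * x) = (1 - c * coordinate_sum n p ^ m) * poly (weight p) c"
    using finite_grid_values by (simp add: weight_def poly_prod prod.remove)
  then show ?thesis using assms(2) by simp
qed

text \<open>
  Together with the following forms, these polynomials in the parameter describe the residues of
  the \<open>e\<close>-th powers of linear forms, freed from denominators: a linear form is given by its values
  \<open>b\<close> at the nodes, and the residues are combined according to the coordinates with
  respect to the nodes.
\<close>

definition system_coeff :: "nat \<Rightarrow> (nat \<Rightarrow> 'k) \<Rightarrow> 'k poly" where
  "system_coeff i p = smult ((\<Prod>l<n. p l) * node_coordinate i p) (weight p)"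

definition system_form :: "(nat \<Rightarrow> 'k) \<Rightarrow> (nat \<Rightarrow> 'k) \<Rightarrow> 'k" where
  "system_form p b = (\<Sum>j<n. node_coordinate j p * b j) ^ e"

text \<open>
  At the nodal parameter only the weights of the multiples of the nodes survive. The \<open>m\<close> multiples
  of one node contribute equally, since the summand is homogeneous of degree \<open>n + 1 + e = nm\<close>.
\<close>

lemma system_at_nodal_parameter:
  obtains \<kappa> where "\<kappa> \<noteq> 0"
    "\<And>i b. i < n \<Longrightarrow> (\<Sum>p\<in>unity_grid m n. poly (system_coeff i p) (1 / N ^ m) * system_form p b) = \<kappa> * b i ^ e"
proof -
  let ?U = "{t :: 'k. t ^ m = 1}" and ?Z = "{p \<in> unity_grid m n. coordinate_sum n p ^ m = N ^ m}"
  define \<omega> where "\<omega> = (\<Prod>x\<in>grid_values - {N ^ m}. 1 - x / N ^ m)"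
  have Nm: "N ^ m \<noteq> 0" using N_neq_0 by simp
  have \<omega>: "\<omega> \<noteq> 0" unfolding \<omega>_def using finite_grid_values Nm by (auto simp: prod_zero_iff field_simps)
  have m0: "0 < m" using m by simp
  have w0: "w \<noteq> 0" using w_root m0 by (auto simp: power_0_left)
  have deg: "n + 1 + e = n * m"
  proof -
    obtain m' where "m = Suc m'" using m by (cases m) auto
    then show ?thesis using e by simp
  qed
  have sum: "(\<Sum>p\<in>unity_grid m n. poly (system_coeff i p) (1 / N ^ m) * system_form p b) = of_nat m * w * \<omega> * b i ^ e"
    if i: "i < n" for i b
  proof -
    let ?F = "\<lambda>p. poly (system_coeff i p) (1 / N ^ m) * system_form p b"
    have "(\<Sum>p\<in>unity_grid m n. ?F p) = (\<Sum>p\<in>?Z. ?F p)"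
    proof (rule sum.mono_neutral_right)
      show "\<forall>p\<in>unity_grid m n - ?Z. ?F p = 0"
      proof
        fix p assume p: "p \<in> unity_grid m n - ?Z"
        have "scaled_node 1 0 \<in> ?Z"
          using bij_betw_imp_surj_on[OF nodes_bij] n by force
        then have "N ^ m \<in> grid_values" unfolding grid_values_def by force
        then have "poly (weight p) (1 / N ^ m) = 0"
          unfolding weight_def poly_prod using p finite_grid_values Nm by (intro prod_zero) auto
        then show "?F p = 0" by (simp add: system_coeff_def)
      qed
    qed (use m0 in auto)
    also have "\<dots> = (\<Sum>(t, l)\<in>?U \<times> {..<n}. ?F (scaled_node t l))"
      using sum.reindex_bij_betw[OF nodes_bij, of ?F] by (simp add: case_prod_unfold)
    also have "\<dots> = (\<Sum>(t, l)\<in>?U \<times> {..<n}. if l = i then w * \<omega> * b i ^ e else 0)"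
    proof (rule sum.cong[OF refl])
      fix x assume "x \<in> ?U \<times> {..<n}"
      then obtain t l where x: "x = (t, l)" and t: "t ^ m = 1" and l: "l < n" by auto
      have prod: "(\<Prod>j<n. scaled_node t l j) = t ^ n * w"
        using l by (simp add: scaled_node_def prod.distrib node_def prod.delta)
      have form: "system_form (scaled_node t l) b = t ^ e * b l ^ e"
        using l by (simp add: system_form_def node_coordinate_scaled_node power_mult_distrib if_distrib[of "\<lambda>x. x * _"] cong: if_cong)
      have wt: "poly (weight (scaled_node t l)) (1 / N ^ m) = \<omega>"
        using l t by (simp add: weight_def \<omega>_def poly_prod coordinate_sum_scaled_node power_mult_distrib)
      have "?F (scaled_node t l) = (if l = i then w * \<omega> * b i ^ e else 0)"
      proof (cases "l = i")
        case True
        have "?F (scaled_node t l) = t ^ n * w * t * \<omega> * (t ^ e * b i ^ e)"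
          using i prod form wt unfolding True by (simp add: system_coeff_def node_coordinate_scaled_node)
        also have "\<dots> = t ^ (n + 1 + e) * (w * \<omega> * b i ^ e)" by (simp add: power_add mult_ac)
        also have "t ^ (n + 1 + e) = 1" unfolding deg using t by (simp add: mult.commute[of n] power_mult)
        finally show ?thesis using True by simp
      next
        case False
        then show ?thesis using l i by (simp add: system_coeff_def node_coordinate_scaled_node)
      qed
      then show "(case x of (t, l) \<Rightarrow> ?F (scaled_node t l)) =
          (case x of (t, l) \<Rightarrow> if l = i then w * \<omega> * b i ^ e else 0)"
        by (simp only: x prod.case)
    qed
    also have "\<dots> = (\<Sum>t\<in>?U. w * \<omega> * b i ^ e)"
      using i by (simp add: sum.cartesian_product[symmetric])
    also have "\<dots> = of_nat m * w * \<omega> * b i ^ e"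
      using card_unity_roots[OF m0, where 'k = 'k] by simp
    finally show ?thesis .
  qed
  show ?thesis
    by (rule that[of "of_nat m * w * \<omega>"]) (use sum \<omega> w0 m0 in auto)
qed

lemma finite_bad_parameters:
  "finite {c. \<exists>b. (\<exists>i<n. b i \<noteq> 0) \<and>
     (\<forall>i<n. (\<Sum>p\<in>unity_grid m n. poly (system_coeff i p) c * system_form p b) = 0)}"
proof -
  obtain \<kappa> where \<kappa>: "\<kappa> \<noteq> 0"
    "\<And>i b. i < n \<Longrightarrow> (\<Sum>p\<in>unity_grid m n. poly (system_coeff i p) (1 / N ^ m) * system_form p b) = \<kappa> * b i ^ e"
    using system_at_nodal_parameter by blast
  show ?thesis
  proof (rule finite_parameters_with_common_zero[OF _ _ \<kappa>])
    show "finite (unity_grid m n :: (nat \<Rightarrow> 'k) set)" using m by simp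
    show "is_form n e (system_form p)" for p
      using is_form_power[OF is_form_linear[of n "\<lambda>j. node_coordinate j p"], of e]
      by (simp add: system_form_def[abs_def])
  qed
qed

text \<open>
  In the coordinates with respect to the nodes, and up to the common factor of the denominators, the
  residues of \<open>l\<^sup>e\<close> are the values of the system at the vector of the values of \<open>l\<close> at the nodes.
\<close>

lemma linear_power_residues:
  assumes regular: "\<And>p. p \<in> unity_grid m n \<Longrightarrow> c * coordinate_sum n p ^ m \<noteq> 1"
    and good: "\<And>b. \<forall>i<n. (\<Sum>p\<in>unity_grid m n. poly (system_coeff i p) c * system_form p b) = 0 \<Longrightarrow> \<forall>i<n. b i = 0"
    and l: "l = (\<Sum>i<n. scale_mpoly (a i) (var i))"
    and residues: "\<And>j. j < n \<Longrightarrow> residue n m c j (l ^ e) = 0"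
  shows "l = 0"
proof -
  let ?b = "\<lambda>j. \<Sum>i<n. a i * node j i"
  let ?Q = "\<Prod>x\<in>grid_values. 1 - c * x"
  define r where "r = (\<lambda>p. (\<Prod>l<n. p l) * eval_mpoly p (l ^ e) / (1 - c * coordinate_sum n p ^ m))"
  have r: "(\<Sum>p\<in>unity_grid m n. p j * r p) = 0" if "j < n" for j
    using residues[OF that] by (simp add: residue_def r_def mult_ac)
  have "(\<Sum>p\<in>unity_grid m n. poly (system_coeff i p) c * system_form p ?b) = 0" if i: "i < n" for i
  proof -
    have "(\<Sum>p\<in>unity_grid m n. poly (system_coeff i p) c * system_form p ?b) =
        (\<Sum>p\<in>unity_grid m n. ?Q / (w - 1) * (p i * r p - (\<Sum>j<n. p j * r p) / N))"
    proof (rule sum.cong[OF refl])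
      fix p :: "nat \<Rightarrow> 'k" assume p: "p \<in> unity_grid m n"
      have "eval_mpoly p (l ^ e) = system_form p ?b"
        by (simp add: l system_form_def sum_node_coordinates)
      then have "poly (system_coeff i p) c * system_form p ?b = node_coordinate i p * (?Q * r p)"
        by (simp add: system_coeff_def weight_regular[OF p regular[OF p]] r_def)
      also have "\<dots> = ?Q / (w - 1) * ((p i - coordinate_sum n p / N) * r p)"
        by (simp add: node_coordinate_def)
      also have "(p i - coordinate_sum n p / N) * r p = p i * r p - (\<Sum>j<n. p j * r p) / N"
        by (simp only: left_diff_distrib coordinate_sum_def sum_distrib_right[symmetric] times_divide_eq_left)
      finally show "poly (system_coeff i p) c * system_form p ?b =
          ?Q / (w - 1) * (p i * r p - (\<Sum>j<n. p j * r p) / N)" .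
    qed
    also have "\<dots> = ?Q / (w - 1) * ((\<Sum>p\<in>unity_grid m n. p i * r p) -
        (\<Sum>p\<in>unity_grid m n. \<Sum>j<n. p j * r p) / N)"
      by (simp only: sum_distrib_left[symmetric] sum_subtractf sum_divide_distrib[symmetric])
    also have "(\<Sum>p\<in>unity_grid m n. \<Sum>j<n. p j * r p) = (\<Sum>j<n. \<Sum>p\<in>unity_grid m n. p j * r p)"
      by (rule sum.swap)
    also have "(\<Sum>j<n. \<Sum>p\<in>unity_grid m n. p j * r p) = 0" using r by simp
    finally show ?thesis using r[OF i] by simp
  qed
  then have "\<forall>j<n. ?b j = 0" using good[of ?b] by blast
  then have "a i = 0" if "i < n" for i using node_system_injective[of a i] that by blast
  then show ?thesis by (simp add: l)
qed

end

lemma good_parameter_exists: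
  fixes n m e :: nat
  assumes n: "3 \<le> n" and m: "2 \<le> m" and e: "n * (m - 1) = e + 1"
  shows "\<exists>c :: 'k::{alg_closed_field, field_char_0}.
    (\<forall>p\<in>unity_grid m n. c * coordinate_sum n p ^ m \<noteq> 1) \<and>
    (\<forall>l\<in>graded_piece n 1. (\<forall>j<n. residue n m c j (l ^ e) = 0) \<longrightarrow> l = 0)"
proof -
  obtain w :: 'k where w: "w ^ m = 1" "\<forall>j. 0 < j \<and> j < m \<longrightarrow> w ^ j \<noteq> 1"
      "\<forall>n\<ge>3. of_nat n - 1 + w \<noteq> 0"
      "\<forall>n z. (\<forall>i<n. z i ^ m = 1) \<and> (\<Sum>i<n. z i) = of_nat n - 1 + w \<longrightarrow>
         (\<exists>l<n. z l = w \<and> (\<forall>i<n. i \<noteq> l \<longrightarrow> z i = 1))"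
    using root_of_unity_with_isolated_sum[OF m] by blast
  interpret nodes: node_configuration n m e w
  proof
    show "w \<noteq> 1" using w(2)[rule_format, of 1] m by simp
    show "of_nat n - 1 + w \<noteq> 0" using w(3) n by blast
    show "\<exists>l<n. z l = w \<and> (\<forall>i<n. i \<noteq> l \<longrightarrow> z i = 1)"
      if "\<forall>i<n. z i ^ m = 1" "(\<Sum>i<n. z i) = of_nat n - 1 + w" for z
      using w(4) that by blast
  qed (fact n m e w(1))+
  let ?sing = "(\<lambda>p. 1 / coordinate_sum n p ^ m) ` (unity_grid m n :: (nat \<Rightarrow> 'k) set)"
  let ?bad = "{c. \<exists>b. (\<exists>i<n. b i \<noteq> 0) \<and>
     (\<forall>i<n. (\<Sum>p\<in>unity_grid m n. poly (nodes.system_coeff i p) c * nodes.system_form p b) = 0)}"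
  have "finite (?sing \<union> ?bad)" using nodes.finite_bad_parameters m by simp
  then obtain c where c: "c \<notin> ?sing \<union> ?bad"
    using ex_new_if_finite[OF infinite_UNIV_char_0] by blast
  have regular: "c * coordinate_sum n p ^ m \<noteq> 1" if p: "p \<in> unity_grid m n" for p
  proof
    assume eq: "c * coordinate_sum n p ^ m = 1"
    then have "coordinate_sum n p ^ m \<noteq> 0" by (metis mult_zero_right zero_neq_one)
    then have "c = 1 / coordinate_sum n p ^ m" using eq by (simp add: field_simps)
    then show False using c p by blast
  qed
  have "l = 0" if l: "l \<in> graded_piece n 1" and res: "\<forall>j<n. residue n m c j (l ^ e) = 0" for l
  proof -
    obtain a where a: "l = (\<Sum>i<n. scale_mpoly (a i) (var i))" using linear_form_cases[OF l] by blast
    show ?thesis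
    proof (rule nodes.linear_power_residues[OF regular _ a])
      show "\<forall>i<n. b i = 0"
        if "\<forall>i<n. (\<Sum>p\<in>unity_grid m n. poly (nodes.system_coeff i p) c * nodes.system_form p b) = 0" for b
        using c that by blast
      show "residue n m c j (l ^ e) = 0" if "j < n" for j using res that by blast
    qed
  qed
  then show ?thesis using regular by blast
qed

section \<open>A smooth Veronese-avoiding hypersurface\<close>

theorem corollary3p9:
  fixes n d :: nat
  assumes "n \<ge> 3" and "d \<ge> 3"
  shows "(smooth_veronese_avoiding_locus n d ::
           'k::{alg_closed_field, field_char_0} mpoly set set) \<noteq> {}"
proof -
  define m where "m = d - 1"
  define e where "e = n * (d - 2) - 1"
  have m: "2 \<le> m" "d = Suc m" "m - 1 = d - 2" using assms(2) by (simp_all add: m_def)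
  have "0 < n * (d - 2)" using assms by simp
  then have e: "n * (m - 1) = e + 1" unfolding m(3) e_def by linarith
  obtain c :: 'k where regular: "\<And>p. p \<in> unity_grid m n \<Longrightarrow> c * coordinate_sum n p ^ m \<noteq> 1"
    and avoiding: "\<And>l. l \<in> graded_piece n 1 \<Longrightarrow> \<forall>j<n. residue n m c j (l ^ e) = 0 \<Longrightarrow> l = 0"
    using good_parameter_exists[OF assms(1) m(1) e] by blast
  interpret pencil: regular_pencil n m e c
    by unfold_locales (fact assms(1) m(1) e regular)+
  let ?f = "pencil_form n (Suc m) c"
  have graded: "?f \<in> graded_piece n d" unfolding m(2) by (rule pencil_form_graded)
  have nonzero: "?f \<noteq> 0"
  proof
    assume "?f = 0"
    moreover have "\<exists>i<n. (\<lambda>_. 1 :: 'k) i \<noteq> 0" using assms(1) by (intro exI[of _ 0]) simp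
    ultimately show False using pencil.no_singular_points[of "\<lambda>_. 1"] by simp
  qed
  have reduced: "reduced_hypersurface n ?f"
    using assms(1) by (intro reduced_if_no_singular_points nonzero pencil.no_singular_points) auto
  have smooth: "smooth_hypersurface n ?f"
    unfolding smooth_hypersurface_def using nonzero pencil.no_singular_points by blast
  have "proj_space (gradient_ideal_piece n ?f e) \<inter> veronese_variety n e = {}"
  proof (rule ccontr)
    assume "proj_space (gradient_ideal_piece n ?f e) \<inter> veronese_variety n e \<noteq> {}"
    then obtain v l where v: "v \<in> gradient_ideal_piece n ?f e" and l: "l \<in> graded_piece n 1" "l \<noteq> 0"
      and eq: "mpoly.span {v} = mpoly.span {l ^ e}"
      unfolding proj_space_def veronese_variety_def proj_point_def by blast
    have "l ^ e \<in> mpoly.span {v}" unfolding eq by (rule mpoly.span_base) simp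
    then obtain t where t: "l ^ e = scale_mpoly t v" by (auto simp: mpoly.span_singleton)
    have "\<forall>j<n. residue n m c j (l ^ e) = 0"
      using v unfolding pencil.gradient_ideal_piece_eq t residue_scale by simp
    then show False using avoiding[OF l(1)] l(2) by blast
  qed
  then have "veronese_avoiding n d ?f"
    using graded reduced pencil.codimension by (simp add: veronese_avoiding_def socle_degree_def e_def Let_def)
  then have "proj_point ?f \<in> smooth_veronese_avoiding_locus n d"
    unfolding smooth_veronese_avoiding_locus_def veronese_avoiding_locus_def smooth_locus_def
    using graded nonzero smooth by blast
  then show ?thesis by blast
qed

end
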